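(* Assume that $\{x:F(x)\preceq_C F(x^0)\}$ is bounded, that $F$ is $(L,C,e)$-smooth relative to $\omega$ for some $L>0$, that $\ell>\frac{L}{1+\alpha(\omega)}$, and that $F$ is $(\mu,C,e)$-strongly convex relative to $\omega$ for some $\mu>0$. Let $\{x^k\}$ be the infinite sequence of nonstationary points generated by $x^{k+1}=V_\ell(x^k)$ from $x^0\in\mathrm{int}(\Omega)$. Then: (i) there exists $F^*\in\mathbb{R}^m$ with $F^*\preceq_C F(x^k)$ for all $k$ and $\lim_{k\to\infty}F(x^k)=F^*$; (ii) $\sum_{k=0}^{\infty}D_\omega(x^{k+1},x^k)<\infty$; (iii) every accumulation point of $\{x^k\}$ is a weakly efficient solution of $\min_{x\in\Omega}F(x)$; and if the Bregman convergence assumption on $\omega$ (stated in the context) holds, then $\{x^k\}$ converges to some weakly efficient solution $x^*$; (iv) under the Bregman convergence assumption, with $x^*$ the limit in (iii), if $\ell\ge L$, then for all $k\ge 0$, $$D_\omega(x^*,x^{k+1})\le\frac{\ell-\delta\mu}{\ell}D_\omega(x^*,x^k).$$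
   Context: $C\subset\mathbb{R}^m$ is a closed, convex, pointed cone with nonempty interior; $y\preceq_C y'$ (resp. $y\prec_C y'$) means $y'-y\in C$ (resp. $\mathrm{int}(C)$). $C^*=\{c^*\in\mathbb{R}^m:\langle c^*,c\rangle\ge 0\ \forall c\in C\}$ and $G=\mathrm{conv}(\{c^*\in C^*:\|c^*\|=1\})$. $\Omega\subset\mathbb{R}^n$ is closed and convex with nonempty interior, $F:\mathbb{R}^n\to\mathbb{R}^m$ is differentiable with Jacobian $JF(x)\in\mathbb{R}^{m\times n}$. A point $x^*\in\Omega$ is $C$-stationary if $JF(x^* )(\Omega-x^* )\cap(-\mathrm{int}(C))=\emptyset$, and is a weakly efficient solution if there is no $x\in\Omega$ with $F(x)\prec_C F(x^* )$. Legendre function: a proper closed convex function $\omega$ on $\mathbb{R}^n$ with values in $(-\infty,+\infty]$ that is essentially smooth (differentiable on $\mathrm{int}(\mathrm{dom}\,\omega)$, with $\|\nabla\omega(x^k)\|\to\infty$ for every sequence $\{x^k\}\subset\mathrm{int}(\mathrm{dom}\,\omega)$ converging to a boundary point of $\mathrm{dom}\,\omega$) and strictly convex on $\mathrm{int}(\mathrm{dom}\,\omega)$. Here $\omega$ is a Legendre function with $\mathrm{cl}(\mathrm{dom}\,\omega)=\Omega$, and it is supercoercive: $\lim_{\|x\|\to\infty}\omega(x)/\|x\|=\infty$. Bregman distance: $D_\omega(x,y)=\omega(x)-\omega(y)-\langle\nabla\omega(y),x-y\rangle$ for $y\in\mathrm{int}(\mathrm{dom}\,\omega)$ (equal to $+\infty$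 when $\omega(x)=+\infty$). Symmetry coefficient: $\alpha(\omega)=\inf\{D_\omega(x,y)/D_\omega(y,x):x,y\in\mathrm{int}(\mathrm{dom}\,\omega),\ x\ne y\}\in[0,1]$. Bregman convergence assumption: (a) if $\{z^k\}\subset\mathrm{int}(\Omega)$ converges to some $z\in\Omega$, then $D_\omega(z,z^k)\to0$; (b) if $z\in\Omega$ and $\{z^k\}\subset\mathrm{int}(\Omega)$ satisfies $D_\omega(z,z^k)\to0$, then $z^k\to z$. The vector $e$: $e=\arg\max_{c\in B[0,r]}\min_{c^*\in G}\langle c^*,c\rangle$, where $B[0,r]$ is the closed ball of radius $r$ centred at $0$ and $r>0$ is selected so that $\max_{c^*\in G}\langle c^*,e\rangle=1$; then $e\in\mathrm{int}(C)$. Set $\delta=\min_{c^*\in G}\langle c^*,e\rangle>0$. Relative smoothness: $F$ is $(L,C,e)$-smooth relative to $\omega$ (on $\Omega\subseteq\mathrm{dom}(\omega)$), with $L>0$, if $F(y)\preceq_C F(x)+JF(x)(y-x)+LD_\omega(y,x)e$ for all $x,y\in\mathrm{int}(\Omega)$. Relative strong convexity: $F$ is $(\mu,C,e)$-strongly convex relative to $\omega$ (on $\Omega\subseteq\mathrm{dom}(\omega)$), with $\mu\ge0$, if $F(x)+JF(x)(y-x)+\mu D_\omega(y,x)e\preceq_C F(y)$ for all $x,y\in\mathrm{int}(\Omega)$. For $\ell>0$ and $x\in\mathrm{int}(\Omega)$: $V_\ell(x)$ is the unique maximizer over $y\in\Omega$ of $\min_{c^*\in G}\{\langle c^*,JF(x)(x-y)\rangle-\ell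 D_\omega(y,x)\}$; it lies in $\mathrm{int}(\Omega)$ (well defined since $\omega$ is supercoercive). The interior Bregman gradient method starts at $x^0\in\mathrm{int}(\Omega)$ and iterates $x^{k+1}=V_\ell(x^k)$, stopping if $x^{k+1}=x^k$; it is assumed throughout that it generates an infinite sequence of points that are not $C$-stationary. *)

theory Defs
  imports "HOL-Analysis.Analysis"
begin

section \<open>The partial orders of a cone and the dual generator\<close>

definition cone_le :: "(real^'m) set \<Rightarrow> real^'m \<Rightarrow> real^'m \<Rightarrow> bool" where
  "cone_le C y y' \<longleftrightarrow> y' - y \<in> C"

definition cone_less :: "(real^'m) set \<Rightarrow> real^'m \<Rightarrow> real^'m \<Rightarrow> bool" where
  "cone_less C y y' \<longleftrightarrow> y' - y \<in> interior C"

definition pointed :: "(real^'m) set \<Rightarrow> bool" where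
  "pointed C \<longleftrightarrow> C \<inter> uminus ` C = {0}"

definition dual_cone :: "(real^'m) set \<Rightarrow> (real^'m) set" where
  "dual_cone C = {cs. \<forall>c\<in>C. cs \<bullet> c \<ge> 0}"

definition dual_gen :: "(real^'m) set \<Rightarrow> (real^'m) set" where
  "dual_gen C = convex hull {cs \<in> dual_cone C. norm cs = 1}"

text \<open>For a closed convex pointed cone \<open>C\<close>, \<open>dual_gen C\<close> is nonempty and compact, so the
  infima and suprema over it below are attained: they are the minima and maxima of the
  mathematical text.\<close>

definition min_gen :: "(real^'m) set \<Rightarrow> real^'m \<Rightarrow> real" where
  "min_gen C v = (INF cs\<in>dual_gen C. cs \<bullet> v)"

definition max_gen :: "(real^'m) set \<Rightarrow> real^'m \<Rightarrow> real" where
  "max_gen C v = (SUP cs\<in>dual_gen C. cs \<bullet> v)"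

definition normalized_direction :: "(real^'m) set \<Rightarrow> real \<Rightarrow> real^'m \<Rightarrow> bool" where
  "normalized_direction C r e \<longleftrightarrow>
     r > 0 \<and> is_arg_max (min_gen C) (\<lambda>c. c \<in> cball 0 r) e \<and> max_gen C e = 1"


section \<open>Solution concepts of vector optimization\<close>

definition C_stationary ::
  "(real^'m) set \<Rightarrow> (real^'n) set \<Rightarrow> (real^'n \<Rightarrow> real^'m) \<Rightarrow> real^'n \<Rightarrow> bool" where
  "C_stationary C \<Omega> F x \<longleftrightarrow>
     x \<in> \<Omega> \<and> (\<lambda>y. jacobian F (at x) *v (y - x)) ` \<Omega> \<inter> uminus ` interior C = {}"

definition weakly_efficient ::
  "(real^'m) set \<Rightarrow> (real^'n) set \<Rightarrow> (real^'n \<Rightarrow> real^'m) \<Rightarrow> real^'n \<Rightarrow> bool" where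
  "weakly_efficient C \<Omega> F x \<longleftrightarrow> x \<in> \<Omega> \<and> \<not> (\<exists>y\<in>\<Omega>. cone_less C (F y) (F x))"

definition accumulation_point :: "(nat \<Rightarrow> 'a::topological_space) \<Rightarrow> 'a \<Rightarrow> bool" where
  "accumulation_point x a \<longleftrightarrow> (\<exists>r::nat \<Rightarrow> nat. strict_mono r \<and> (x \<circ> r) \<longlonglongrightarrow> a)"


section \<open>Legendre functions\<close>

definition eff_dom :: "(real^'n \<Rightarrow> ereal) \<Rightarrow> (real^'n) set" where
  "eff_dom \<omega> = {x. \<omega> x < \<infinity>}"

definition epi :: "(real^'n \<Rightarrow> ereal) \<Rightarrow> ((real^'n) \<times> real) set" where
  "epi \<omega> = {(x, t). \<omega> x \<le> ereal t}"

definition proper_fun :: "(real^'n \<Rightarrow> ereal) \<Rightarrow> bool" where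
  "proper_fun \<omega> \<longleftrightarrow> (\<forall>x. \<omega> x \<noteq> -\<infinity>) \<and> eff_dom \<omega> \<noteq> {}"

text \<open>Only meaningful at points of differentiability, in particular inside the interior of
  the effective domain.\<close>

definition grad :: "(real^'n \<Rightarrow> ereal) \<Rightarrow> real^'n \<Rightarrow> real^'n" where
  "grad \<omega> x = (THE g. GDERIV (\<lambda>z. real_of_ereal (\<omega> z)) x :> g)"

definition essentially_smooth :: "(real^'n \<Rightarrow> ereal) \<Rightarrow> bool" where
  "essentially_smooth \<omega> \<longleftrightarrow>
     (\<forall>x\<in>interior (eff_dom \<omega>). (\<lambda>z. real_of_ereal (\<omega> z)) differentiable (at x)) \<and>
     (\<forall>xs b. (\<forall>k. xs k \<in> interior (eff_dom \<omega>)) \<and> b \<in> frontier (eff_dom \<omega>) \<and> xs \<longlonglongrightarrow> b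
        \<longrightarrow> filterlim (\<lambda>k. norm (grad \<omega> (xs k))) at_top sequentially)"

definition strictly_convex_on :: "(real^'n) set \<Rightarrow> (real^'n \<Rightarrow> ereal) \<Rightarrow> bool" where
  "strictly_convex_on S \<omega> \<longleftrightarrow> convex S \<and>
     (\<forall>x\<in>S. \<forall>y\<in>S. \<forall>u>0. \<forall>v>0. x \<noteq> y \<and> u + v = 1 \<longrightarrow>
        \<omega> (u *\<^sub>R x + v *\<^sub>R y) < ereal u * \<omega> x + ereal v * \<omega> y)"

definition Legendre :: "(real^'n \<Rightarrow> ereal) \<Rightarrow> bool" where
  "Legendre \<omega> \<longleftrightarrow> proper_fun \<omega> \<and> closed (epi \<omega>) \<and> convex (epi \<omega>) \<and>
     essentially_smooth \<omega> \<and> strictly_convex_on (interior (eff_dom \<omega>)) \<omega>"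

definition supercoercive :: "(real^'n \<Rightarrow> ereal) \<Rightarrow> bool" where
  "supercoercive \<omega> \<longleftrightarrow> ((\<lambda>x. \<omega> x / ereal (norm x)) \<longlongrightarrow> \<infinity>) at_infinity"


section \<open>Bregman distances\<close>

text \<open>\<open>bregman \<omega> x y\<close> is used only for \<open>y\<close> in the interior of the effective domain; there
  \<open>\<omega> y\<close> is finite, so the value is \<open>\<infinity>\<close> exactly when \<open>\<omega> x = \<infinity>\<close>.\<close>

definition bregman :: "(real^'n \<Rightarrow> ereal) \<Rightarrow> real^'n \<Rightarrow> real^'n \<Rightarrow> ereal" where
  "bregman \<omega> x y = \<omega> x - \<omega> y - ereal (grad \<omega> y \<bullet> (x - y))"

definition symmetry_coeff :: "(real^'n \<Rightarrow> ereal) \<Rightarrow> real" where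
  "symmetry_coeff \<omega> =
     Inf {real_of_ereal (bregman \<omega> x y) / real_of_ereal (bregman \<omega> y x) | x y.
            x \<in> interior (eff_dom \<omega>) \<and> y \<in> interior (eff_dom \<omega>) \<and> x \<noteq> y}"

definition bregman_convergence :: "(real^'n) set \<Rightarrow> (real^'n \<Rightarrow> ereal) \<Rightarrow> bool" where
  "bregman_convergence \<Omega> \<omega> \<longleftrightarrow>
     (\<forall>zs z. (\<forall>k. zs k \<in> interior \<Omega>) \<and> z \<in> \<Omega> \<and> zs \<longlonglongrightarrow> z
        \<longrightarrow> (\<lambda>k. bregman \<omega> z (zs k)) \<longlonglongrightarrow> 0) \<and>
     (\<forall>zs z. (\<forall>k. zs k \<in> interior \<Omega>) \<and> z \<in> \<Omega> \<and> (\<lambda>k. bregman \<omega> z (zs k)) \<longlonglongrightarrow> 0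
        \<longrightarrow> zs \<longlonglongrightarrow> z)"

definition rel_smooth ::
  "real \<Rightarrow> (real^'m) set \<Rightarrow> real^'m \<Rightarrow> (real^'n) set \<Rightarrow> (real^'n \<Rightarrow> ereal) \<Rightarrow> (real^'n \<Rightarrow> real^'m) \<Rightarrow> bool" where
  "rel_smooth L C e \<Omega> \<omega> F \<longleftrightarrow> \<Omega> \<subseteq> eff_dom \<omega> \<and>
     (\<forall>x\<in>interior \<Omega>. \<forall>y\<in>interior \<Omega>.
        cone_le C (F y)
          (F x + jacobian F (at x) *v (y - x) + (L * real_of_ereal (bregman \<omega> y x)) *\<^sub>R e))"

definition rel_strongly_convex ::
  "real \<Rightarrow> (real^'m) set \<Rightarrow> real^'m \<Rightarrow> (real^'n) set \<Rightarrow> (real^'n \<Rightarrow> ereal) \<Rightarrow> (real^'n \<Rightarrow> real^'m) \<Rightarrow> bool" where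
  "rel_strongly_convex \<mu> C e \<Omega> \<omega> F \<longleftrightarrow> \<Omega> \<subseteq> eff_dom \<omega> \<and>
     (\<forall>x\<in>interior \<Omega>. \<forall>y\<in>interior \<Omega>.
        cone_le C
          (F x + jacobian F (at x) *v (y - x) + (\<mu> * real_of_ereal (bregman \<omega> y x)) *\<^sub>R e)
          (F y))"


section \<open>The interior Bregman gradient step\<close>

definition step_objective ::
  "(real^'m) set \<Rightarrow> (real^'n \<Rightarrow> ereal) \<Rightarrow> (real^'n \<Rightarrow> real^'m) \<Rightarrow> real \<Rightarrow> real^'n \<Rightarrow> real^'n \<Rightarrow> ereal" where
  "step_objective C \<omega> F l x y =
     (INF cs\<in>dual_gen C.
        ereal (cs \<bullet> (jacobian F (at x) *v (x - y))) - ereal l * bregman \<omega> y x)"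

definition bregman_step ::
  "(real^'m) set \<Rightarrow> (real^'n) set \<Rightarrow> (real^'n \<Rightarrow> ereal) \<Rightarrow> (real^'n \<Rightarrow> real^'m) \<Rightarrow> real \<Rightarrow> real^'n \<Rightarrow> real^'n" where
  "bregman_step C \<Omega> \<omega> F l x = arg_max_on (step_objective C \<omega> F l x) \<Omega>"

end

theory Submission
  imports Defs
begin

text \<open>A step from \<open>x\<close> to \<open>y\<close> minimizes the support function of the transposed Jacobian image of
  \<open>dual_gen C\<close> at \<open>z - x\<close> plus \<open>l * D z x\<close>. Supercoercivity gives a minimizer, essential
  smoothness keeps it in the interior, and its optimality condition yields \<open>c \<in> dual_gen C\<close> with
  \<open>c \<bullet> J x w = l * ((\<nabla>\<omega> x - \<nabla>\<omega> y) \<bullet> w)\<close> that is maximal at \<open>w = y - x\<close>. Relative smoothness and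
  the symmetry coefficient then make every scalarization of \<open>F\<close> decrease by at least
  \<open>(l * (1 + \<alpha>) - L) * D y x\<close>, so the values converge and the \<open>D y x\<close> are summable. With the
  three point identity, strong convexity and smoothness give for every feasible \<open>z\<close>

  \<open>l * D z y \<le> (l - \<mu> * \<delta>) * D z x + (L - l) * D y x + c \<bullet> (F z - F y)\<close>.

  If \<open>F z\<close> were strictly below the limit value, the last term would be bounded away from zero and
  \<open>D z\<close> would become negative along the iterates. If \<open>z\<close> is an accumulation point, the last term is
  nonpositive: the iterates are quasi-Fejer monotone with respect to \<open>z\<close>, and for \<open>l \<ge> L\<close> the
  inequality is the linear rate.\<close>

section \<open>Cones and their dual generators\<close>

lemma dual_gen_norm_le:
  assumes "c \<in> dual_gen C" shows "norm c \<le> 1"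
proof -
  have "dual_gen C \<subseteq> cball 0 1"
    unfolding dual_gen_def by (rule hull_minimal) auto
  with assms show ?thesis by auto
qed

lemma closed_dual_cone: "closed (dual_cone C)"
proof -
  have "dual_cone C = (\<Inter>c\<in>C. {cs. 0 \<le> cs \<bullet> c})"
    by (auto simp: dual_cone_def)
  moreover have "closed {cs. 0 \<le> cs \<bullet> c}" for c :: "real^'m"
    by (intro closed_Collect_le continuous_intros)
  ultimately show ?thesis by auto
qed

lemma convex_dual_cone: "convex (dual_cone C)"
  by (auto simp: convex_def dual_cone_def inner_add_left)

lemma dual_gen_subset: "dual_gen C \<subseteq> dual_cone C"
  unfolding dual_gen_def by (rule hull_minimal) (auto simp: convex_dual_cone)

text \<open>The unit vectors of the closed dual cone form a compact set, and in finite dimension the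
  convex hull preserves compactness. This is what makes the extrema over \<open>dual_gen C\<close>
  attained.\<close>

lemma compact_dual_gen: "compact (dual_gen C)"
proof -
  have "{cs \<in> dual_cone C. norm cs = 1} = dual_cone C \<inter> sphere 0 1"
    by auto
  then show ?thesis
    unfolding dual_gen_def
    by (metis closed_Int_compact closed_dual_cone compact_convex_hull compact_sphere)
qed

lemma convex_dual_gen: "convex (dual_gen C)"
  by (simp add: dual_gen_def)

lemma dual_gen_inner_abs_le:
  assumes "c \<in> dual_gen C" shows "\<bar>c \<bullet> v\<bar> \<le> norm v"
proof -
  have "\<bar>c \<bullet> v\<bar> \<le> norm c * norm v" by (rule Cauchy_Schwarz_ineq2)
  also have "\<dots> \<le> 1 * norm v"
    by (intro mult_right_mono dual_gen_norm_le[OF assms]) auto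
  finally show ?thesis by simp
qed

lemma bdd_above_dual_gen: "bdd_above ((\<lambda>c. c \<bullet> v) ` dual_gen C)"
  by (rule bdd_aboveI2[of _ _ "norm v"]) (use dual_gen_inner_abs_le abs_le_D1 in blast)

lemma bdd_below_dual_gen: "bdd_below ((\<lambda>c. c \<bullet> v) ` dual_gen C)"
  by (rule bdd_belowI2[of _ "- norm v"]) (meson abs_le_D2 dual_gen_inner_abs_le minus_le_iff)

lemma min_gen_le: "c \<in> dual_gen C \<Longrightarrow> min_gen C v \<le> c \<bullet> v"
  unfolding min_gen_def by (rule cINF_lower[OF bdd_below_dual_gen])

lemma max_gen_ge: "c \<in> dual_gen C \<Longrightarrow> c \<bullet> v \<le> max_gen C v"
  unfolding max_gen_def by (rule cSUP_upper[OF _ bdd_above_dual_gen])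

locale solid_pointed_cone =
  fixes C :: "(real^'m) set"
  assumes closed: "closed C" and convex: "convex C" and cone: "cone C"
    and pointed: "pointed C" and solid: "interior C \<noteq> {}"
begin

text \<open>The predicate \<open>cone\<close> admits the empty set; it is the equation with
  \<open>{0}\<close> in \<open>pointed\<close> that supplies the origin.\<close>

lemma zero_mem: "0 \<in> C"
  using pointed by (auto simp: pointed_def)

text \<open>The normal of a strictly separating hyperplane must be nonnegative on \<open>C\<close>:
  a negative value could be scaled down to the separating level. Normalizing it then gives a
  generator.\<close>

lemma separation:
  assumes "v \<notin> C" shows "\<exists>c\<in>dual_gen C. c \<bullet> v < 0"
proof -
  obtain a b where ab: "a \<bullet> v < b" "\<And>x. x \<in> C \<Longrightarrow> b < a \<bullet> x"
    using separating_hyperplane_closed_point[OF convex closed assms] by blast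
  have b: "b < 0" using ab(2)[OF zero_mem] by simp
  have nonneg: "0 \<le> a \<bullet> x" if "x \<in> C" for x
  proof (rule ccontr)
    assume "\<not> 0 \<le> a \<bullet> x"
    then have ax: "a \<bullet> x < 0" by simp
    define s where "s = b / (a \<bullet> x)"
    have "s > 0" using b ax by (simp add: s_def divide_neg_neg)
    then have "s *\<^sub>R x \<in> C" using cone that by (simp add: cone_def)
    from ab(2)[OF this] show False using ax by (simp add: s_def)
  qed
  have a: "a \<noteq> 0" using ab(1) b by auto
  have "a /\<^sub>R norm a \<in> dual_gen C"
    unfolding dual_gen_def
    by (rule hull_inc) (use nonneg a in \<open>auto simp: dual_cone_def\<close>)
  moreover have "(a /\<^sub>R norm a) \<bullet> v < 0"
    using a ab(1) b by (simp add: mult_pos_neg)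
  ultimately show ?thesis by blast
qed

text \<open>The bipolar theorem for the normalized generators. It reduces every cone inequality to
  its scalarizations.\<close>

lemma mem_iff: "v \<in> C \<longleftrightarrow> (\<forall>c\<in>dual_gen C. 0 \<le> c \<bullet> v)"
proof
  show "\<forall>c\<in>dual_gen C. 0 \<le> c \<bullet> v" if "v \<in> C"
    using that dual_gen_subset[of C] by (auto simp: dual_cone_def)
  show "v \<in> C" if "\<forall>c\<in>dual_gen C. 0 \<le> c \<bullet> v"
    using that separation[of v] by (meson not_le)
qed

text \<open>A pointed cone is not the whole space, and separating any point outside it produces a
  generator.\<close>

lemma dual_gen_nonempty: "dual_gen C \<noteq> {}"
proof -
  have "C \<noteq> UNIV"
  proof
    assume "C = UNIV"
    then have "C \<inter> uminus ` C = UNIV" by (auto simp: surj_def)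
    with pointed have "(UNIV :: (real^'m) set) = {0}" by (simp add: pointed_def)
    then have "axis undefined 1 = (0 :: real^'m)" by (metis UNIV_I singletonD)
    then show False by (simp add: axis_eq_0_iff)
  qed
  then show ?thesis using separation by blast
qed

lemma min_gen_attained: obtains c where "c \<in> dual_gen C" "min_gen C v = c \<bullet> v"
proof -
  obtain c where c: "c \<in> dual_gen C" "\<forall>c'\<in>dual_gen C. c \<bullet> v \<le> c' \<bullet> v"
    using continuous_attains_inf[OF compact_dual_gen dual_gen_nonempty, of "\<lambda>c. c \<bullet> v"]
      continuous_on_inner[OF continuous_on_id continuous_on_const] by blast
  have "c \<bullet> v \<le> min_gen C v"
    unfolding min_gen_def by (rule cINF_greatest[OF dual_gen_nonempty]) (use c in auto)
  then show thesis using that[OF c(1)] min_gen_le[OF c(1), of v] by simp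
qed

section \<open>Calculus of the support function of the dual generator\<close>

lemma max_gen_le:
  assumes "\<And>c. c \<in> dual_gen C \<Longrightarrow> c \<bullet> v \<le> b" shows "max_gen C v \<le> b"
  unfolding max_gen_def by (rule cSUP_least[OF dual_gen_nonempty assms])

text \<open>Translates the max-min form of the step into the minimization of a convex support
  function.\<close>

lemma min_gen_uminus: "min_gen C (- v) = - max_gen C v"
proof (rule antisym)
  have "max_gen C v \<le> - min_gen C (- v)"
    by (rule max_gen_le) (use min_gen_le[of _ C "- v"] in force)
  then show "min_gen C (- v) \<le> - max_gen C v" by simp
  obtain c where "c \<in> dual_gen C" "min_gen C (- v) = c \<bullet> (- v)"
    by (rule min_gen_attained)
  with max_gen_ge[of c C v] show "- max_gen C v \<le> min_gen C (- v)" by simp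
qed

lemma max_gen_zero: "max_gen C 0 = 0"
  using dual_gen_nonempty by (simp add: max_gen_def)

lemma max_gen_add_le: "max_gen C (u + v) \<le> max_gen C u + max_gen C v"
  by (rule max_gen_le) (simp add: inner_add_right add_mono max_gen_ge)

lemma max_gen_scale_le:
  assumes "0 \<le> s" shows "max_gen C (s *\<^sub>R v) \<le> s * max_gen C v"
  by (rule max_gen_le) (simp add: assms max_gen_ge mult_left_mono)

lemma max_gen_diff_le: "max_gen C u - max_gen C v \<le> norm (u - v)"
proof -
  have "max_gen C (v + (u - v)) \<le> max_gen C v + max_gen C (u - v)"
    by (rule max_gen_add_le)
  moreover have "max_gen C (u - v) \<le> norm (u - v)"
    by (rule max_gen_le) (use dual_gen_inner_abs_le abs_le_D1 in blast)
  ultimately show ?thesis by simp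
qed

text \<open>If the ball of radius \<open>d\<close> around \<open>v\<close> lies in \<open>C\<close>,
  moving from \<open>v\<close> by \<open>d\<close> against a unit dual vector stays in
  \<open>C\<close>, so that vector has inner product at least \<open>d\<close> with
  \<open>v\<close>. The bound defines a halfspace and hence passes to the convex hull.\<close>

lemma min_gen_pos_interior:
  assumes "v \<in> interior C" shows "0 < min_gen C v"
proof -
  obtain d where d: "d > 0" "cball v d \<subseteq> C"
    using assms by (meson mem_interior_cball)
  have "{cs \<in> dual_cone C. norm cs = 1} \<subseteq> {c. d \<le> c \<bullet> v}"
  proof clarify
    fix c assume c: "c \<in> dual_cone C" "norm c = 1"
    have "v - d *\<^sub>R c \<in> C" using d c by (auto simp: dist_norm subset_iff)
    then have "0 \<le> c \<bullet> (v - d *\<^sub>R c)" using c(1) by (auto simp: dual_cone_def)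
    then show "d \<le> c \<bullet> v"
      using c(2) by (simp add: inner_diff_right dot_square_norm)
  qed
  then have "dual_gen C \<subseteq> {c. d \<le> c \<bullet> v}"
    unfolding dual_gen_def
    by (rule hull_minimal) (use convex_halfspace_ge[of d v] in \<open>simp add: inner_commute\<close>)
  moreover obtain c where "c \<in> dual_gen C" "min_gen C v = c \<bullet> v"
    by (rule min_gen_attained)
  ultimately show ?thesis using d(1) by auto
qed

text \<open>A positive multiple of an interior point fits into the ball over which \<open>e\<close>
  is maximal, and \<open>min_gen C\<close> is already positive there.\<close>

lemma min_gen_normalized_direction_pos:
  assumes "normalized_direction C r e" shows "0 < min_gen C e"
proof -
  obtain v where v: "v \<in> interior C" using solid by blast
  define s where "s = r / (norm v + 1)"
  have r: "r > 0" using assms by (simp add: normalized_direction_def)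
  have s: "s > 0" using r by (simp add: s_def add_nonneg_pos)
  have "0 < norm v + 1" by (simp add: add_nonneg_pos)
  then have "norm (s *\<^sub>R v) \<le> r"
    using r by (simp add: s_def divide_simps algebra_simps)
  then have "s *\<^sub>R v \<in> cball 0 r" by simp
  then have "min_gen C (s *\<^sub>R v) \<le> min_gen C e"
    using assms by (auto simp: normalized_direction_def is_arg_max_linorder)
  moreover obtain c where c: "c \<in> dual_gen C" "min_gen C (s *\<^sub>R v) = c \<bullet> (s *\<^sub>R v)"
    by (rule min_gen_attained)
  moreover have "0 < c \<bullet> (s *\<^sub>R v)"
    using min_gen_pos_interior[OF v] min_gen_le[OF c(1), of v] s by simp
  ultimately show ?thesis by linarith
qed

text \<open>Here \<open>\<lambda>w. max_gen C (J *v w)\<close> is the support function of the compact convex image of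
  \<open>dual_gen C\<close> under the transpose of \<open>J\<close>.\<close>
lemma dominated_by_max_gen:
  fixes J :: "real^'n^'m"
  assumes "\<And>w. p \<bullet> w \<le> max_gen C (J *v w)"
  obtains c where "c \<in> dual_gen C" "\<And>w. c \<bullet> (J *v w) = p \<bullet> w"
proof -
  define A where "A = (\<lambda>c. c v* J) ` dual_gen C"
  have lin: "linear (\<lambda>c. c v* J)"
    by (simp add: linear_iff vector_matrix_left_distrib scaleR_vector_matrix_assoc)
  have "compact A" unfolding A_def
    by (intro compact_continuous_image linear_continuous_on linear_conv_bounded_linear[THEN iffD1]
        lin compact_dual_gen)
  then have "closed A" by (rule compact_imp_closed)
  have "convex A" unfolding A_def by (rule convex_linear_image[OF lin convex_dual_gen])
  have "p \<in> A"
  proof (rule ccontr)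
    assume "p \<notin> A"
    then obtain a b where ab: "a \<bullet> p < b" "\<And>q. q \<in> A \<Longrightarrow> b < a \<bullet> q"
      using separating_hyperplane_closed_point[OF \<open>convex A\<close> \<open>closed A\<close>] by blast
    \<comment> \<open>Evaluated at \<open>- a\<close>, the support function is at most
      \<open>- b\<close>, which is strictly below \<open>p \<bullet> (- a)\<close>, against the
      hypothesis.\<close>
    have "max_gen C (J *v (- a)) \<le> - b"
    proof (rule max_gen_le)
      fix c assume "c \<in> dual_gen C"
      then have "b < a \<bullet> (c v* J)" by (auto simp: A_def intro: ab(2))
      then show "c \<bullet> (J *v (- a)) \<le> - b"
        by (metis dot_lmul_matrix inner_commute inner_minus_left less_imp_le neg_le_iff_le)
    qed
    with assms[of "- a"] ab(1) show False by (simp add: inner_commute)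
  qed
  then obtain c where "c \<in> dual_gen C" "p = c v* J" by (auto simp: A_def)
  then show thesis using that[of c] by (simp add: dot_lmul_matrix)
qed

text \<open>Generators have norm at most 1, so only the operator norm of \<open>J\<close> enters.
  Both the existence of a minimizer and its interiority rest on this bound.\<close>

lemma lipschitz_max_gen:
  fixes J :: "real^'n^'m"
  shows "(onorm ((*v) J))-lipschitz_on UNIV (\<lambda>z. max_gen C (J *v (z - x)))"
proof (rule lipschitz_onI)
  fix u v :: "real^'n"
  have J: "bounded_linear ((*v) J)" by (rule matrix_vector_mul_bounded_linear)
  have *: "max_gen C (J *v (u - x)) - max_gen C (J *v (v - x)) \<le> onorm ((*v) J) * dist u v" for u v
  proof -
    have "max_gen C (J *v (u - x)) - max_gen C (J *v (v - x)) \<le> norm (J *v (u - x) - J *v (v - x))"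
      by (rule max_gen_diff_le)
    also have "J *v (u - x) - J *v (v - x) = J *v (u - v)"
      by (simp add: matrix_vector_mult_diff_distrib)
    also have "norm \<dots> \<le> onorm ((*v) J) * norm (u - v)" by (rule onorm[OF J])
    finally show ?thesis by (simp add: dist_norm)
  qed
  show "dist (max_gen C (J *v (u - x))) (max_gen C (J *v (v - x))) \<le> onorm ((*v) J) * dist u v"
    using *[of u v] *[of v u] by (simp add: dist_real_def dist_commute abs_le_iff)
  show "0 \<le> onorm ((*v) J)" by (rule onorm_pos_le[OF J])
qed

lemma convex_max_gen:
  fixes J :: "real^'n^'m"
  shows "convex_on UNIV (\<lambda>z. max_gen C (J *v (z - x)))"
proof (rule convex_onI)
  fix t :: real and u v :: "real^'n"
  assume t: "0 < t" "t < 1"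
  have "J *v ((1 - t) *\<^sub>R u + t *\<^sub>R v - x) = (1 - t) *\<^sub>R (J *v (u - x)) + t *\<^sub>R (J *v (v - x))"
    by (simp add: matrix_vector_mult_diff_distrib matrix_vector_right_distrib
        matrix_vector_mult_scaleR algebra_simps)
  then have "max_gen C (J *v ((1 - t) *\<^sub>R u + t *\<^sub>R v - x))
      \<le> max_gen C ((1 - t) *\<^sub>R (J *v (u - x))) + max_gen C (t *\<^sub>R (J *v (v - x)))"
    by (simp add: max_gen_add_le)
  also have "\<dots> \<le> (1 - t) * max_gen C (J *v (u - x)) + t * max_gen C (J *v (v - x))"
    using t by (intro add_mono max_gen_scale_le) auto
  finally show "max_gen C (J *v ((1 - t) *\<^sub>R u + t *\<^sub>R v - x))
      \<le> (1 - t) * max_gen C (J *v (u - x)) + t * max_gen C (J *v (v - x))" .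
qed auto

section \<open>The cone order and its decreasing sequences\<close>

lemma cone_le_antisym: "cone_le C u v \<Longrightarrow> cone_le C v u \<Longrightarrow> u = v"
proof -
  assume "cone_le C u v" "cone_le C v u"
  then have "v - u \<in> C \<inter> uminus ` C" by (force simp: cone_le_def)
  with pointed show "u = v" by (simp add: pointed_def)
qed

lemma cone_le_iff: "cone_le C u v \<longleftrightarrow> (\<forall>c\<in>dual_gen C. c \<bullet> u \<le> c \<bullet> v)"
  by (simp add: cone_le_def mem_iff inner_diff_right)

lemma cone_le_refl: "cone_le C u u"
  by (simp add: cone_le_iff)

lemma cone_le_trans: "cone_le C u v \<Longrightarrow> cone_le C v w \<Longrightarrow> cone_le C u w"
  unfolding cone_le_iff by (meson order_trans)

lemma cone_le_limit:
  assumes "X \<longlonglongrightarrow> u" "Y \<longlonglongrightarrow> v" "\<forall>\<^sub>F n in sequentially. cone_le C (X n) (Y n)"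
  shows "cone_le C u v"
  unfolding cone_le_def
  by (rule Lim_in_closed_set[OF closed _ _ tendsto_diff[OF assms(2,1)]])
     (use assms(3) in \<open>simp_all add: cone_le_def\<close>)

text \<open>Two limit points of a decreasing sequence lie below each other, hence agree since the
  cone is pointed.\<close>
lemma bounded_decreasing_convergent:
  assumes dec: "\<And>k. cone_le C (X (Suc k)) (X k)" and bdd: "bounded (range X)"
  obtains u where "\<And>k. cone_le C u (X k)" "X \<longlonglongrightarrow> u"
proof -
  have mono: "cone_le C (X k) (X j)" if "j \<le> k" for j k
    using that by (induction k rule: dec_induct)
      (auto intro: cone_le_refl cone_le_trans dec)
  \<comment> \<open>Late terms of a subsequence lie below any fixed \<open>X k\<close>; closedness
    of \<open>C\<close> passes this to the limit.\<close>
  have sub: "cone_le C u (X k)" if r: "strict_mono r" "(X \<circ> r) \<longlonglongrightarrow> u" for r u k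
  proof (rule cone_le_limit[OF r(2) tendsto_const])
    show "\<forall>\<^sub>F n in sequentially. cone_le C ((X \<circ> r) n) (X k)"
      using eventually_ge_at_top[of k]
      by eventually_elim (metis r(1) mono seq_suble le_trans comp_apply)
  qed
  obtain u r where r: "strict_mono r" "(X \<circ> r) \<longlonglongrightarrow> u"
    using bounded_imp_convergent_subsequence[OF bdd] by blast
  have "X \<longlonglongrightarrow> u"
  proof (rule ccontr)
    assume "\<not> X \<longlonglongrightarrow> u"
    then obtain d where d: "d > 0" "\<not> (\<forall>\<^sub>F n in sequentially. dist (X n) u < d)"
      by (auto simp: tendsto_iff)
    then have "infinite {n. \<not> dist (X n) u < d}"
      by (metis cofinite_eq_sequentially eventually_cofinite)
    \<comment> \<open>The infinitely many terms at distance at least \<open>d\<close> from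
      \<open>u\<close> are enumerated by \<open>s\<close>; boundedness gives them a limit point
      \<open>v\<close> of their own.\<close>
    then obtain s :: "nat \<Rightarrow> nat" where s: "strict_mono s" "\<And>n. \<not> dist (X (s n)) u < d"
      using infinite_enumerate[of "{n. \<not> dist (X n) u < d}"] by auto
    have "bounded (range (X \<circ> s))"
      by (rule bounded_subset[OF bdd]) auto
    then obtain v t where t: "strict_mono t" "((X \<circ> s) \<circ> t) \<longlonglongrightarrow> v"
      using bounded_imp_convergent_subsequence by blast
    have st: "strict_mono (s \<circ> t)" "(X \<circ> (s \<circ> t)) \<longlonglongrightarrow> v"
      using s(1) t by (simp_all add: strict_mono_o comp_assoc)
    have "cone_le C u v"
      by (rule cone_le_limit[OF tendsto_const st(2)]) (simp add: sub[OF r])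
    moreover have "cone_le C v u"
      by (rule cone_le_limit[OF tendsto_const r(2)]) (simp add: sub[OF st])
    ultimately have "u = v" by (rule cone_le_antisym)
    with tendstoD[OF st(2) d(1)] have "\<forall>\<^sub>F n in sequentially. dist ((X \<circ> (s \<circ> t)) n) u < d"
      by simp
    then show False using s(2) by simp
  qed
  with sub[OF r] show thesis by (rule that)
qed

end

section \<open>Bregman proximal steps\<close>

text \<open>A real-valued rendering of a Legendre function that is finite exactly on a closed
  domain: the value infinity becomes non-membership in \<open>\<Omega>\<close>, lower semicontinuity
  the closed epigraph, essential smoothness \<open>gradient\<close> and \<open>blow_up\<close>, and
  supercoercivity \<open>superlinear\<close>.\<close>

locale legendre_fun =
  fixes \<Omega> :: "'a::euclidean_space set" and f :: "'a \<Rightarrow> real" and g :: "'a \<Rightarrow> 'a"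
  assumes closed_domain: "closed \<Omega>" and convex_domain: "convex \<Omega>"
    and closed_epigraph: "closed {(z, t). z \<in> \<Omega> \<and> f z \<le> t}"
    and convex_fun: "convex_on \<Omega> f"
    and gradient: "y \<in> interior \<Omega> \<Longrightarrow> GDERIV f y :> g y"
    and blow_up: "(\<And>k. xs k \<in> interior \<Omega>) \<Longrightarrow> b \<in> frontier \<Omega> \<Longrightarrow> xs \<longlonglongrightarrow> b
      \<Longrightarrow> filterlim (\<lambda>k. norm (g (xs k))) at_top sequentially"
    and superlinear: "\<exists>R. \<forall>z\<in>\<Omega>. R \<le> norm z \<longrightarrow> M * norm z \<le> f z"
begin

definition breg :: "'a \<Rightarrow> 'a \<Rightarrow> real" where
  "breg z y = f z - f y - g y \<bullet> (z - y)"

lemma breg_three_point: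
  "(g x - g y) \<bullet> (z - y) = breg z y + breg y x - breg z x"
  by (simp add: breg_def algebra_simps inner_diff_right inner_diff_left)

lemma directional_derivative:
  assumes "y \<in> interior \<Omega>"
  shows "((\<lambda>t. (f (y + t *\<^sub>R v) - f y) / t) \<longlongrightarrow> g y \<bullet> v) (at_right 0)"
proof -
  have 1: "(f has_derivative (\<lambda>h. h \<bullet> g y)) (at (y + 0 *\<^sub>R v))"
    using gradient[OF assms] by (simp add: gderiv_def)
  have 2: "((\<lambda>t::real. y + t *\<^sub>R v) has_derivative (\<lambda>t. t *\<^sub>R v)) (at 0)"
    by (auto intro!: derivative_eq_intros)
  have "((\<lambda>t. f (y + t *\<^sub>R v)) has_derivative (\<lambda>t. (t *\<^sub>R v) \<bullet> g y)) (at 0)"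
    using has_derivative_compose[OF 2 1] .
  then have "((\<lambda>t. f (y + t *\<^sub>R v)) has_field_derivative (g y \<bullet> v)) (at 0)"
    by (simp add: has_field_derivative_def inner_commute mult_commute_abs)
  then have "((\<lambda>t. (f (y + t *\<^sub>R v) - f y) / t) \<longlongrightarrow> g y \<bullet> v) (at 0)"
    by (simp add: DERIV_def)
  then show ?thesis by (rule filterlim_mono) (auto simp: at_le)
qed

text \<open>By convexity the difference quotients from \<open>y\<close> towards \<open>z\<close>
  stay below the full secant slope, also when \<open>z\<close> is a boundary point; so does their
  limit.\<close>

lemma tangent_below:
  assumes y: "y \<in> interior \<Omega>" and z: "z \<in> \<Omega>"
  shows "f y + g y \<bullet> (z - y) \<le> f z"
proof -
  have "g y \<bullet> (z - y) \<le> f z - f y"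
  proof (rule tendsto_upperbound[OF directional_derivative[OF y]])
    have "\<forall>\<^sub>F t in at_right (0::real). t \<in> {0<..<1}"
      by (rule eventually_at_right_real) simp
    then show "\<forall>\<^sub>F t in at_right (0::real). (f (y + t *\<^sub>R (z - y)) - f y) / t \<le> f z - f y"
    proof eventually_elim
      case (elim t)
      have "f ((1 - t) *\<^sub>R y + t *\<^sub>R z) \<le> (1 - t) * f y + t * f z"
        by (rule convex_onD[OF convex_fun]) (use elim y z interior_subset in auto)
      moreover have "(1 - t) *\<^sub>R y + t *\<^sub>R z = y + t *\<^sub>R (z - y)"
        by (simp add: algebra_simps)
      ultimately show ?case using elim by (simp add: divide_simps algebra_simps)
    qed
  qed simp
  then show ?thesis by simp
qed

lemma breg_nonneg: "y \<in> interior \<Omega> \<Longrightarrow> z \<in> \<Omega> \<Longrightarrow> 0 \<le> breg z y"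
  using tangent_below by (simp add: breg_def algebra_simps)

lemma continuous_interior: "continuous_on (interior \<Omega>) f"
  by (metis GDERIV_subst continuous_at_imp_continuous_on gderiv_def gradient
      has_derivative_continuous)

text \<open>The objective is minimized over the epigraph of \<open>f\<close>, on which it is continuous, because
  \<open>f\<close> itself need not be continuous at the boundary of \<open>\<Omega>\<close>.\<close>
lemma prox_exists:
  assumes x: "x \<in> interior \<Omega>" and l: "l > 0"
    and lip: "K-lipschitz_on UNIV \<phi>"
  shows "\<exists>y\<in>\<Omega>. \<forall>z\<in>\<Omega>. \<phi> y + l * breg y x \<le> \<phi> z + l * breg z x"
proof -
  define H where "H = (\<lambda>p. \<phi> (fst p) + l * (snd p - f x - g x \<bullet> (fst p - x)))"
  \<comment> \<open>The sublevel set at \<open>\<phi> x\<close> contains \<open>(x, f x)\<close>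
    because the Bregman term vanishes there. It remains to show that it is bounded.\<close>
  define S where "S = {(z, t). z \<in> \<Omega> \<and> f z \<le> t} \<inter> {p. H p \<le> \<phi> x}"
  have x\<Omega>: "x \<in> \<Omega>" using x interior_subset by blast
  have cont\<phi>: "continuous_on UNIV \<phi>" by (rule lipschitz_on_continuous_on[OF lip])
  have contH: "continuous_on UNIV H"
    unfolding H_def
    by (intro continuous_intros continuous_on_compose2[OF cont\<phi>]) auto
  have "closed S"
    unfolding S_def
    by (intro closed_Int closed_epigraph closed_Collect_le continuous_intros contH)
  have K: "0 \<le> K" by (rule lipschitz_on_nonneg[OF lip])
  define B where "B = K / l + norm (g x)"
  define A where "A = B * norm x + \<bar>f x\<bar>"
  have B: "B \<ge> 0" using K l by (simp add: B_def)
  have A: "A \<ge> 0" using B by (simp add: A_def)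
  \<comment> \<open>The slope \<open>B + 1\<close> exceeds by one the slope \<open>B\<close> of the
    upper bound on \<open>t\<close> below, which forces \<open>norm z <= A\<close> once
    \<open>norm z\<close> reaches \<open>R\<close>.\<close>
  obtain R where R: "\<And>z. z \<in> \<Omega> \<Longrightarrow> R \<le> norm z \<Longrightarrow> (B + 1) * norm z \<le> f z"
    using superlinear[of "B + 1"] by blast
  define Q where "Q = max R A"
  have upper: "t \<le> B * norm z + A" if "(z, t) \<in> S" for z t
  proof -
    have "H (z, t) \<le> \<phi> x" using that by (simp add: S_def)
    moreover have "\<phi> x - \<phi> z \<le> K * norm (z - x)"
      using lipschitz_onD[OF lip, of x z] by (simp add: dist_norm norm_minus_commute)
    ultimately have "l * t \<le> K * norm (z - x) + l * (f x + g x \<bullet> (z - x))"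
      by (simp add: H_def algebra_simps)
    then have "t \<le> K / l * norm (z - x) + (f x + g x \<bullet> (z - x))"
      using l by (simp add: field_simps)
    also have "\<dots> \<le> K / l * norm (z - x) + (\<bar>f x\<bar> + norm (g x) * norm (z - x))"
      by (intro add_mono norm_cauchy_schwarz) auto
    also have "\<dots> = B * norm (z - x) + \<bar>f x\<bar>"
      by (simp add: B_def algebra_simps)
    also have "\<dots> \<le> B * (norm z + norm x) + \<bar>f x\<bar>"
      by (intro add_mono mult_left_mono norm_triangle_ineq4 B) auto
    finally show ?thesis by (simp add: A_def algebra_simps)
  qed
  have zQ: "norm z \<le> Q" if "(z, t) \<in> S" for z t
  proof (cases "R \<le> norm z")
    case True
    have "z \<in> \<Omega>" "f z \<le> t" using that by (auto simp: S_def)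
    with R[OF _ True] upper[OF that] have "(B + 1) * norm z \<le> B * norm z + A" by fastforce
    then show ?thesis by (simp add: Q_def algebra_simps)
  qed (simp add: Q_def)
  have lower: "- \<bar>f x\<bar> - norm (g x) * (Q + norm x) \<le> t" if "(z, t) \<in> S" for z t
  proof -
    have "\<bar>g x \<bullet> (z - x)\<bar> \<le> norm (g x) * norm (z - x)" by (rule Cauchy_Schwarz_ineq2)
    also have "\<dots> \<le> norm (g x) * (Q + norm x)"
      by (intro mult_left_mono order_trans[OF norm_triangle_ineq4] add_mono zQ[OF that]) auto
    finally have "\<bar>g x \<bullet> (z - x)\<bar> \<le> norm (g x) * (Q + norm x)" .
    moreover have "f x + g x \<bullet> (z - x) \<le> t"
      using that tangent_below[OF x, of z] by (auto simp: S_def)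
    ultimately show ?thesis by linarith
  qed
  have "S \<subseteq> cball 0 Q \<times> {- \<bar>f x\<bar> - norm (g x) * (Q + norm x) .. B * Q + A}"
  proof
    fix p assume p: "p \<in> S"
    obtain z t where zt: "p = (z, t)" by (cases p)
    have "B * norm z \<le> B * Q" using zQ p B by (auto simp: zt intro!: mult_left_mono)
    then show "p \<in> cball 0 Q \<times> {- \<bar>f x\<bar> - norm (g x) * (Q + norm x) .. B * Q + A}"
      using upper[of z t] lower[of z t] zQ[of z t] p by (simp add: zt)
  qed
  then have "bounded S"
    by (rule bounded_subset[rotated]) (intro bounded_Times bounded_cball bounded_closed_interval)
  with \<open>closed S\<close> have "compact S" by (simp add: compact_eq_bounded_closed)
  moreover have "(x, f x) \<in> S" using x\<Omega> by (simp add: S_def H_def)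
  ultimately obtain p where p: "p \<in> S" "\<And>q. q \<in> S \<Longrightarrow> H p \<le> H q"
    using continuous_attains_inf[of S H] continuous_on_subset[OF contH] by blast
  obtain y t where yt: "p = (y, t)" by (cases p)
  have y: "y \<in> \<Omega>" "f y \<le> t" using p(1) by (auto simp: S_def yt)
  have Hb: "H (z, f z) = \<phi> z + l * breg z x" for z
    by (simp add: H_def breg_def)
  \<comment> \<open>Lowering the second component from \<open>t\<close> to \<open>f y\<close> cannot
    increase \<open>H\<close>, so a minimizer on the epigraph gives one on the graph.\<close>
  have "H (y, f y) \<le> H p"
    using y(2) l by (simp add: H_def yt)
  have "H (y, f y) \<le> H (z, f z)" if z: "z \<in> \<Omega>" for z
  proof (cases "(z, f z) \<in> S")
    case True
    then show ?thesis using p(2) \<open>H (y, f y) \<le> H p\<close> by force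
  next
    case False
    then have "\<phi> x < H (z, f z)" using z by (auto simp: S_def)
    moreover have "H p \<le> \<phi> x" using p(1) by (simp add: S_def)
    ultimately show ?thesis using \<open>H (y, f y) \<le> H p\<close> by linarith
  qed
  then show ?thesis using y(1) by (auto simp: Hb)
qed

text \<open>At a boundary minimizer the derivatives of \<open>f\<close> along the segment towards \<open>x\<close> would stay
  bounded below; comparison with \<open>f\<close> on a ball around \<open>x\<close> then bounds the full gradients.\<close>
lemma prox_interior:
  assumes x: "x \<in> interior \<Omega>" and l: "l > 0"
    and lip: "K-lipschitz_on UNIV \<phi>"
    and y: "y \<in> \<Omega>" and min: "\<And>z. z \<in> \<Omega> \<Longrightarrow> \<phi> y + l * breg y x \<le> \<phi> z + l * breg z x"
  shows "y \<in> interior \<Omega>"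
proof (rule ccontr)
  assume "y \<notin> interior \<Omega>"
  then have bd: "y \<in> frontier \<Omega>"
    using y closed_domain by (simp add: frontier_def)
  define t where "t n = inverse (real (Suc n))" for n
  define z where "z n = y - t n *\<^sub>R (y - x)" for n
  have t: "0 < t n" "t n \<le> 1" for n by (auto simp: t_def divide_simps)
  have zint: "z n \<in> interior \<Omega>" for n
    unfolding z_def by (rule mem_interior_convex_shrink[OF convex_domain x y t])
  have z\<Omega>: "z n \<in> \<Omega>" for n using zint interior_subset by blast
  have "t \<longlonglongrightarrow> 0" unfolding t_def by (rule LIMSEQ_inverse_real_of_nat)
  then have "z \<longlonglongrightarrow> y - 0 *\<^sub>R (y - x)" unfolding z_def by (intro tendsto_intros)
  then have "z \<longlonglongrightarrow> y" by simp
  with zint bd have lim: "filterlim (\<lambda>n. norm (g (z n))) at_top sequentially"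
    by (rule blow_up)
  define M where "M = \<bar>K * norm (x - y) / l - g x \<bullet> (x - y)\<bar>"
  \<comment> \<open>Comparing the minimizer \<open>y\<close> with \<open>z n\<close>, the Lipschitz
    bound and the tangent at \<open>z n\<close> give terms proportional to \<open>t n\<close>;
    dividing by \<open>t n\<close> leaves a bound free of \<open>n\<close>.\<close>
  have D: "- M \<le> g (z n) \<bullet> (x - y)" for n
  proof -
    have "f (z n) - t n * (g (z n) \<bullet> (x - y)) \<le> f y"
      using tangent_below[OF zint y, of n] by (simp add: z_def inner_diff_right algebra_simps)
    moreover have "\<phi> (z n) - \<phi> y \<le> K * (t n * norm (x - y))"
      using lipschitz_onD[OF lip, of "z n" y] t(1)[of n]
      by (simp add: dist_norm z_def norm_minus_commute)
    moreover have "\<phi> y + l * breg y x \<le> \<phi> (z n) + l * breg (z n) x"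
      by (rule min[OF z\<Omega>])
    moreover have "breg y x - breg (z n) x = f y - f (z n) + t n * (g x \<bullet> (x - y))"
      by (simp add: breg_def z_def inner_diff_right algebra_simps)
    ultimately have "l * (t n * (g x \<bullet> (x - y)) - t n * (g (z n) \<bullet> (x - y)))
        \<le> K * (t n * norm (x - y))"
      using mult_left_mono[of "t n * (g x \<bullet> (x - y)) - t n * (g (z n) \<bullet> (x - y))"
          "breg y x - breg (z n) x" l] l
      by (simp add: algebra_simps)
    then have "t n * (l * (g x \<bullet> (x - y) - g (z n) \<bullet> (x - y))) \<le> t n * (K * norm (x - y))"
      by (simp add: algebra_simps)
    then have "l * (g x \<bullet> (x - y) - g (z n) \<bullet> (x - y)) \<le> K * norm (x - y)"
      using t(1)[of n] by simp
    then have "g x \<bullet> (x - y) - g (z n) \<bullet> (x - y) \<le> K * norm (x - y) / l"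
      using l by (simp add: pos_le_divide_eq mult.commute)
    then show ?thesis unfolding M_def by linarith
  qed
  obtain \<epsilon> where \<epsilon>: "\<epsilon> > 0" "cball x \<epsilon> \<subseteq> interior \<Omega>"
    using x open_contains_cball[of "interior \<Omega>"] by auto
  have "compact (f ` cball x \<epsilon>)"
    by (intro compact_continuous_image continuous_on_subset[OF continuous_interior] \<epsilon> compact_cball)
  then obtain b where b: "\<And>w. w \<in> cball x \<epsilon> \<Longrightarrow> \<bar>f w\<bar> \<le> b"
    by (meson compact_imp_bounded bounded_real image_eqI)
  define Q where "Q = (b + M - f x + norm (g x) * norm (x - y)) / \<epsilon>"
  have bound: "norm (g (z n)) \<le> Q" for n
  proof -
    \<comment> \<open>Among the points of the ball, \<open>w\<close> is extremal in the direction of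
      the gradient at \<open>z n\<close>, so the tangent inequality at \<open>w\<close> contains
      \<open>\<epsilon>\<close> times its full norm.\<close>
    define w where "w = x + \<epsilon> *\<^sub>R sgn (g (z n))"
    have w: "w \<in> cball x \<epsilon>" using \<epsilon>(1) by (simp add: w_def dist_norm norm_sgn)
    have "w - z n = (1 - t n) *\<^sub>R (x - y) + \<epsilon> *\<^sub>R sgn (g (z n))"
      by (simp add: w_def z_def algebra_simps)
    moreover have "g (z n) \<bullet> sgn (g (z n)) = norm (g (z n))"
      by (cases "g (z n) = 0") (simp_all add: sgn_div_norm dot_square_norm power2_eq_square)
    ultimately have "g (z n) \<bullet> (w - z n)
        = (1 - t n) * (g (z n) \<bullet> (x - y)) + \<epsilon> * norm (g (z n))"
      by (simp add: inner_add_right)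
    moreover have "(1 - t n) * (- M) \<le> (1 - t n) * (g (z n) \<bullet> (x - y))"
      using t(2)[of n] D[of n] by (intro mult_left_mono) auto
    moreover have "- M \<le> (1 - t n) * (- M)"
      using t(1)[of n] by (simp add: M_def algebra_simps)
    moreover have "f (z n) + g (z n) \<bullet> (w - z n) \<le> f w"
      using tangent_below[OF zint] w \<epsilon>(2) interior_subset by blast
    moreover have "f w \<le> b" using b[OF w] by linarith
    moreover have "f x - norm (g x) * norm (x - y) \<le> f (z n)"
    proof -
      have "z n - x = (1 - t n) *\<^sub>R (y - x)" by (simp add: z_def algebra_simps)
      then have "norm (z n - x) = (1 - t n) * norm (x - y)"
        using t(2)[of n] by (simp add: norm_minus_commute)
      also have "\<dots> \<le> 1 * norm (x - y)"
        using t(1)[of n] by (intro mult_right_mono) auto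
      finally have "norm (g x) * norm (z n - x) \<le> norm (g x) * norm (x - y)"
        by (simp add: mult_left_mono)
      moreover have "\<bar>g x \<bullet> (z n - x)\<bar> \<le> norm (g x) * norm (z n - x)"
        by (rule Cauchy_Schwarz_ineq2)
      ultimately show ?thesis using tangent_below[OF x z\<Omega>[of n]] by linarith
    qed
    ultimately have "\<epsilon> * norm (g (z n)) \<le> b + M - f x + norm (g x) * norm (x - y)"
      by linarith
    then show ?thesis using \<epsilon>(1) by (simp add: Q_def pos_le_divide_eq mult.commute)
  qed
  have "\<forall>\<^sub>F n in sequentially. Q + 1 \<le> norm (g (z n))"
    using lim by (simp add: filterlim_at_top)
  then obtain n where "Q + 1 \<le> norm (g (z n))"
    by (auto simp: eventually_sequentially)
  with bound[of n] show False by simp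
qed

text \<open>Along a short move from \<open>y\<close> towards \<open>z\<close>, convexity controls
  \<open>\<phi>\<close> while \<open>f\<close> is differentiated. As \<open>y\<close> is interior,
  only nearby points need lie in \<open>\<Omega>\<close>, so \<open>z\<close> ranges over the whole
  space.\<close>

lemma prox_subgradient:
  assumes y: "y \<in> interior \<Omega>" and l: "l > 0" and cvx: "convex_on UNIV \<phi>"
    and min: "\<And>z. z \<in> \<Omega> \<Longrightarrow> \<phi> y + l * breg y x \<le> \<phi> z + l * breg z x"
  shows "\<phi> y + l * ((g x - g y) \<bullet> (z - y)) \<le> \<phi> z"
proof -
  have lim: "((\<lambda>t. l * ((f (y + t *\<^sub>R (z - y)) - f y) / t) - l * (g x \<bullet> (z - y)))
      \<longlongrightarrow> l * (g y \<bullet> (z - y)) - l * (g x \<bullet> (z - y))) (at_right 0)"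
    by (intro tendsto_intros directional_derivative[OF y])
  have "((\<lambda>t. y + t *\<^sub>R (z - y)) \<longlongrightarrow> y + 0 *\<^sub>R (z - y)) (at_right (0::real))"
    by (intro tendsto_intros)
  then have near: "\<forall>\<^sub>F t in at_right (0::real). y + t *\<^sub>R (z - y) \<in> interior \<Omega>"
    by (rule topological_tendstoD) (use y in auto)
  have "\<forall>\<^sub>F t in at_right (0::real). t \<in> {0<..<1}"
    by (rule eventually_at_right_real) simp
  with near have "\<forall>\<^sub>F t in at_right (0::real). \<phi> y - \<phi> z
      \<le> l * ((f (y + t *\<^sub>R (z - y)) - f y) / t) - l * (g x \<bullet> (z - y))"
  proof eventually_elim
    case (elim t)
    define w where "w = y + t *\<^sub>R (z - y)"
    have t: "0 < t" "t < 1" using elim by auto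
    have "w = (1 - t) *\<^sub>R y + t *\<^sub>R z" by (simp add: w_def algebra_simps)
    then have "\<phi> w \<le> (1 - t) * \<phi> y + t * \<phi> z"
      using convex_onD[OF cvx, of t y z] t by simp
    moreover have "\<phi> y + l * breg y x \<le> \<phi> w + l * breg w x"
      using elim interior_subset by (intro min) (auto simp: w_def)
    moreover have "breg w x - breg y x = (f w - f y) - t * (g x \<bullet> (z - y))"
      by (simp add: breg_def w_def inner_diff_right inner_add_right algebra_simps)
    then have "l * breg w x - l * breg y x = l * (f w - f y) - l * (t * (g x \<bullet> (z - y)))"
      by (metis right_diff_distrib)
    ultimately have "t * (\<phi> y - \<phi> z) \<le> l * (f w - f y) - l * (t * (g x \<bullet> (z - y)))"
      by (simp add: algebra_simps)
    also have "\<dots> = t * (l * ((f w - f y) / t) - l * (g x \<bullet> (z - y)))"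
      using t by (simp add: field_simps)
    finally show ?case using t by (simp add: w_def)
  qed
  from tendsto_lowerbound[OF lim this]
  show ?thesis by (simp add: inner_diff_left right_diff_distrib)
qed

end

section \<open>The Bregman gradient iteration\<close>

text \<open>Subtracting the partial sums of the errors leaves a decreasing sequence bounded below by
  \<open>- suminf b\<close>.\<close>

lemma quasi_fejer_convergent:
  fixes a b :: "nat \<Rightarrow> real"
  assumes step: "\<And>n. a (Suc n) \<le> a n + b n" and nonneg: "\<And>n. 0 \<le> a n"
    and b: "summable b" "\<And>n. 0 \<le> b n"
  shows "convergent a"
proof -
  define c where "c n = a n - (\<Sum>i<n. b i)" for n
  have "decseq c"
    using step by (simp add: decseq_Suc_iff c_def algebra_simps)
  moreover have "- suminf b \<le> c n" for n
    using sum_le_suminf[OF b(1), of "{..<n}"] b(2) nonneg[of n] by (simp add: c_def)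
  ultimately obtain u where "c \<longlonglongrightarrow> u" by (metis decseq_convergent)
  then have "(\<lambda>n. c n + (\<Sum>i<n. b i)) \<longlonglongrightarrow> u + suminf b"
    by (intro tendsto_add summable_LIMSEQ b)
  then show ?thesis by (auto simp: c_def convergent_def)
qed

text \<open>The two step assumptions are conditional on an interior iterate, since a minimizer is
  only known to exist around such a centre; interiority of all iterates then follows by
  induction.\<close>

locale bregman_gradient =
  solid_pointed_cone C + legendre_fun \<Omega> f g
  for C :: "(real^'m) set" and \<Omega> :: "(real^'n) set" and f :: "real^'n \<Rightarrow> real"
    and g :: "real^'n \<Rightarrow> real^'n" +
  fixes F :: "real^'n \<Rightarrow> real^'m" and J :: "real^'n \<Rightarrow> real^'n^'m" and e :: "real^'m"
    and L \<mu> l \<alpha> \<delta> :: real and x :: "nat \<Rightarrow> real^'n"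
  assumes continuous_F: "continuous_on UNIV F"
    and e_bounds: "c \<in> dual_gen C \<Longrightarrow> \<delta> \<le> c \<bullet> e" "c \<in> dual_gen C \<Longrightarrow> c \<bullet> e \<le> 1"
    and \<delta>_pos: "\<delta> > 0"
    and L_pos: "L > 0" and \<mu>_pos: "\<mu> > 0" and l_pos: "l > 0"
    and smooth: "y \<in> interior \<Omega> \<Longrightarrow> z \<in> interior \<Omega> \<Longrightarrow>
      cone_le C (F z) (F y + J y *v (z - y) + (L * breg z y) *\<^sub>R e)"
    and strong: "y \<in> interior \<Omega> \<Longrightarrow> z \<in> interior \<Omega> \<Longrightarrow>
      cone_le C (F y + J y *v (z - y) + (\<mu> * breg z y) *\<^sub>R e) (F z)"
    and symmetry: "y \<in> interior \<Omega> \<Longrightarrow> z \<in> interior \<Omega> \<Longrightarrow> \<alpha> * breg y z \<le> breg z y"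
    and step_size: "L < l * (1 + \<alpha>)"
    and start: "x 0 \<in> interior \<Omega>"
    and level_bounded: "bounded {z. cone_le C (F z) (F (x 0))}"
    and step_mem: "x k \<in> interior \<Omega> \<Longrightarrow> x (Suc k) \<in> \<Omega>"
    and step_min: "x k \<in> interior \<Omega> \<Longrightarrow> z \<in> \<Omega> \<Longrightarrow>
      max_gen C (J (x k) *v (x (Suc k) - x k)) + l * breg (x (Suc k)) (x k)
        \<le> max_gen C (J (x k) *v (z - x k)) + l * breg z (x k)"
begin

lemma iterates_interior: "x k \<in> interior \<Omega>"
proof (induction k)
  case (Suc k)
  from prox_interior[OF Suc l_pos lipschitz_max_gen step_mem[OF Suc] step_min[OF Suc]]
  show ?case .
qed (rule start)

lemma iterates_mem: "x k \<in> \<Omega>"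
  using iterates_interior interior_subset by blast

text \<open>The subgradient inequality is tested far out on rays from \<open>x k\<close>, along which the support
  function is homogeneous, so that its constant terms drop out.\<close>
lemma multiplier:
  obtains c where "c \<in> dual_gen C"
    "\<And>w. c \<bullet> (J (x k) *v w) = l * ((g (x k) - g (x (Suc k))) \<bullet> w)"
    "\<And>c'. c' \<in> dual_gen C \<Longrightarrow>
      c' \<bullet> (J (x k) *v (x (Suc k) - x k)) \<le> c \<bullet> (J (x k) *v (x (Suc k) - x k))"
proof -
  let ?x = "x k" and ?y = "x (Suc k)"
  define \<phi> where "\<phi> z = max_gen C (J ?x *v (z - ?x))" for z
  define p where "p = l *\<^sub>R (g ?x - g ?y)"
  have sub: "\<phi> ?y + p \<bullet> (z - ?y) \<le> \<phi> z" for z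
    using prox_subgradient[OF iterates_interior l_pos convex_max_gen step_min[OF iterates_interior]]
    by (simp add: \<phi>_def p_def)
  have "p \<bullet> w \<le> max_gen C (J ?x *v w)" for w
  proof -
    have "s * (p \<bullet> w - max_gen C (J ?x *v w)) \<le> p \<bullet> (?y - ?x) - \<phi> ?y" if "s > 0" for s
    proof -
      have "\<phi> (?x + s *\<^sub>R w) \<le> s * max_gen C (J ?x *v w)"
        using max_gen_scale_le[of s "J ?x *v w"] that
        by (simp add: \<phi>_def matrix_vector_mult_scaleR)
      moreover have "p \<bullet> (?x + s *\<^sub>R w - ?y) = s * (p \<bullet> w) - p \<bullet> (?y - ?x)"
        by (simp add: inner_diff_right inner_add_right)
      ultimately show ?thesis
        using sub[of "?x + s *\<^sub>R w"] by (simp add: right_diff_distrib)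
    qed note bound = this
    show ?thesis
    proof (rule ccontr)
      assume "\<not> ?thesis"
      then have pos: "0 < p \<bullet> w - max_gen C (J ?x *v w)" by simp
      define B where "B = p \<bullet> (?y - ?x) - \<phi> ?y"
      \<comment> \<open>Chosen so that the ray inequality would read
        \<open>\<bar>B\<bar> + 1 \<le> B\<close>.\<close>
      define s where "s = (\<bar>B\<bar> + 1) / (p \<bullet> w - max_gen C (J ?x *v w))"
      have "s > 0" using pos by (simp add: s_def)
      from bound[OF this] pos show False by (simp add: s_def B_def)
    qed
  qed
  then obtain c where c: "c \<in> dual_gen C" "\<And>w. c \<bullet> (J ?x *v w) = p \<bullet> w"
    using dominated_by_max_gen[of p "J ?x"] by blast
  \<comment> \<open>At the current iterate \<open>\<phi>\<close> vanishes, so this instance shows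
    that \<open>c\<close> attains the support function at \<open>?y - ?x\<close>.\<close>
  have "\<phi> ?y + p \<bullet> (?x - ?y) \<le> 0"
    using sub[of ?x] by (simp add: \<phi>_def max_gen_zero)
  then have "\<phi> ?y \<le> c \<bullet> (J ?x *v (?y - ?x))"
    by (simp add: c(2) inner_diff_right)
  then have "c' \<bullet> (J ?x *v (?y - ?x)) \<le> c \<bullet> (J ?x *v (?y - ?x))" if "c' \<in> dual_gen C" for c'
    using max_gen_ge[OF that, of "J ?x *v (?y - ?x)"] by (simp add: \<phi>_def)
  then show thesis
    using that[OF c(1)] c(2) by (simp add: p_def)
qed

lemma descent:
  assumes c: "c \<in> dual_gen C"
  shows "c \<bullet> F (x (Suc k)) \<le> c \<bullet> F (x k) - (l * (1 + \<alpha>) - L) * breg (x (Suc k)) (x k)"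
proof -
  let ?x = "x k" and ?y = "x (Suc k)"
  note int = iterates_interior[of k] iterates_interior[of "Suc k"]
  obtain m where m: "\<And>w. m \<bullet> (J ?x *v w) = l * ((g ?x - g ?y) \<bullet> w)"
    "\<And>c'. c' \<in> dual_gen C \<Longrightarrow> c' \<bullet> (J ?x *v (?y - ?x)) \<le> m \<bullet> (J ?x *v (?y - ?x))"
    using multiplier by metis
  have "c \<bullet> F ?y \<le> c \<bullet> F ?x + c \<bullet> (J ?x *v (?y - ?x)) + (L * breg ?y ?x) * (c \<bullet> e)"
    using smooth[OF int] c by (simp add: cone_le_iff inner_add_right)
  \<comment> \<open>Maximality replaces the arbitrary scalarization \<open>c\<close> by the
    multiplier \<open>m\<close>, whose value on the step is a symmetrized Bregman distance.\<close>
  also have "\<dots> \<le> c \<bullet> F ?x + m \<bullet> (J ?x *v (?y - ?x)) + (L * breg ?y ?x) * 1"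
    using breg_nonneg[OF int(1) iterates_mem[of "Suc k"]] L_pos
    by (intro add_mono m(2) mult_left_mono e_bounds c) auto
  also have "m \<bullet> (J ?x *v (?y - ?x)) = - l * (breg ?x ?y + breg ?y ?x)"
    unfolding m(1) by (simp add: breg_def inner_diff_left inner_diff_right algebra_simps)
  also have "\<dots> \<le> - l * (\<alpha> * breg ?y ?x + breg ?y ?x)"
    using symmetry[OF int(2,1)] l_pos by (simp add: mult_left_mono)
  finally show ?thesis by (simp add: algebra_simps)
qed

section \<open>Monotone values, bounded iterates and summable steps\<close>

lemma breg_steps_nonneg: "0 \<le> breg (x (Suc k)) (x k)"
  by (rule breg_nonneg[OF iterates_interior iterates_mem])

lemma decreasing: "cone_le C (F (x (Suc k))) (F (x k))"
  unfolding cone_le_iff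
proof
  fix c assume "c \<in> dual_gen C"
  moreover have "0 \<le> (l * (1 + \<alpha>) - L) * breg (x (Suc k)) (x k)"
    using step_size breg_steps_nonneg[of k] by (intro mult_nonneg_nonneg) auto
  ultimately show "c \<bullet> F (x (Suc k)) \<le> c \<bullet> F (x k)"
    using descent[of c k] by linarith
qed

lemma bounded_iterates: "bounded (range x)"
proof (rule bounded_subset[OF level_bounded])
  have "cone_le C (F (x k)) (F (x 0))" for k
    by (induction k) (auto intro: cone_le_refl cone_le_trans decreasing)
  then show "range x \<subseteq> {z. cone_le C (F z) (F (x 0))}" by blast
qed

lemma values_converge:
  obtains u where "\<And>k. cone_le C u (F (x k))" "(\<lambda>k. F (x k)) \<longlonglongrightarrow> u"
proof (rule bounded_decreasing_convergent)
  show "bounded (range (\<lambda>k. F (x k)))"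
  proof (rule bounded_subset)
    show "bounded (F ` closure (range x))"
      using bounded_iterates continuous_on_subset[OF continuous_F]
      by (intro compact_imp_bounded compact_continuous_image) (auto simp: compact_closure)
    show "range (\<lambda>k. F (x k)) \<subseteq> F ` closure (range x)"
      using closure_subset by blast
  qed
qed (use decreasing that in auto)

text \<open>One scalarization suffices: its decreases telescope to a finite sum and dominate the
  step distances up to the positive factor \<open>\<sigma>\<close>.\<close>

lemma summable_breg_steps: "summable (\<lambda>k. breg (x (Suc k)) (x k))"
proof -
  obtain u where u: "\<And>k. cone_le C u (F (x k))" "(\<lambda>k. F (x k)) \<longlonglongrightarrow> u"
    using values_converge by metis
  obtain c where c: "c \<in> dual_gen C" using dual_gen_nonempty by blast
  define \<sigma> where "\<sigma> = l * (1 + \<alpha>) - L"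
  have \<sigma>: "\<sigma> > 0" using step_size by (simp add: \<sigma>_def)
  have lim: "(\<lambda>k. c \<bullet> F (x k)) \<longlonglongrightarrow> c \<bullet> u" by (intro tendsto_intros u)
  have "summable (\<lambda>k. (c \<bullet> F (x k) - c \<bullet> F (x (Suc k))) / \<sigma>)"
    by (intro summable_divide telescope_summable'[OF lim])
  then show ?thesis
  proof (rule summable_comparison_test'[where N = 0])
    fix k
    have "\<sigma> * breg (x (Suc k)) (x k) \<le> c \<bullet> F (x k) - c \<bullet> F (x (Suc k))"
      using descent[OF c, of k] by (simp add: \<sigma>_def)
    then show "norm (breg (x (Suc k)) (x k)) \<le> (c \<bullet> F (x k) - c \<bullet> F (x (Suc k))) / \<sigma>"
      using \<sigma> breg_steps_nonneg[of k] by (simp add: pos_le_divide_eq mult.commute)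
  qed
qed

text \<open>The scalarized inequality says that \<open>z\<close> lies in the preimage of the closed epigraph of \<open>f\<close>
  under a continuous map; this carries it from the interior to \<open>\<Omega>\<close> without continuity of \<open>f\<close>.\<close>
lemma strong_closed:
  assumes c: "c \<in> dual_gen C" and y: "y \<in> interior \<Omega>" and z: "z \<in> \<Omega>"
  shows "c \<bullet> F y + c \<bullet> (J y *v (z - y)) + \<mu> * \<delta> * breg z y \<le> c \<bullet> F z"
proof -
  define q where "q = \<mu> * (c \<bullet> e)"
  have q: "q > 0" using e_bounds(1)[OF c] \<delta>_pos \<mu>_pos by (simp add: q_def)
  \<comment> \<open>Obtained by solving the scalarized inequality for \<open>f z\<close>, which
    \<open>q > 0\<close> permits.\<close>
  define s where "s z = (c \<bullet> F z - c \<bullet> F y - c \<bullet> (J y *v (z - y))) / q + f y + g y \<bullet> (z - y)" for z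
  have cont: "continuous_on UNIV (\<lambda>z. (z, s z))"
    unfolding s_def
    by (intro continuous_intros continuous_F matrix_vector_mult_linear_continuous_on
        continuous_on_compose2[OF matrix_vector_mult_linear_continuous_on]) (use q in auto)
  have closed: "closed ((\<lambda>z. (z, s z)) -` {(z, t). z \<in> \<Omega> \<and> f z \<le> t})"
    by (rule closed_vimage[OF closed_epigraph cont])
  have iff: "f z \<le> s z \<longleftrightarrow> c \<bullet> F y + c \<bullet> (J y *v (z - y)) + q * breg z y \<le> c \<bullet> F z" for z
  proof -
    have "f z \<le> s z \<longleftrightarrow> breg z y \<le> (c \<bullet> F z - c \<bullet> F y - c \<bullet> (J y *v (z - y))) / q"
      by (auto simp: s_def breg_def)
    also have "\<dots> \<longleftrightarrow> q * breg z y \<le> c \<bullet> F z - c \<bullet> F y - c \<bullet> (J y *v (z - y))"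
      using q by (simp add: pos_le_divide_eq mult.commute)
    finally show ?thesis by linarith
  qed
  have "interior \<Omega> \<subseteq> (\<lambda>z. (z, s z)) -` {(z, t). z \<in> \<Omega> \<and> f z \<le> t}"
  proof
    fix w assume w: "w \<in> interior \<Omega>"
    have "c \<bullet> F y + c \<bullet> (J y *v (w - y)) + q * breg w y \<le> c \<bullet> F w"
      using strong[OF y w] c by (simp add: cone_le_iff inner_add_right q_def algebra_simps)
    then show "w \<in> (\<lambda>z. (z, s z)) -` {(z, t). z \<in> \<Omega> \<and> f z \<le> t}"
      using w interior_subset by (auto simp: iff)
  qed
  from closure_minimal[OF this closed]
  \<comment> \<open>A closed convex set with an interior point, here \<open>y\<close>, is the
    closure of its interior.\<close>
  have "\<Omega> \<subseteq> (\<lambda>z. (z, s z)) -` {(z, t). z \<in> \<Omega> \<and> f z \<le> t}"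
    using convex_closure_interior[OF convex_domain] y closed_domain by auto
  then have "f z \<le> s z" using z by auto
  then have "c \<bullet> F y + c \<bullet> (J y *v (z - y)) + q * breg z y \<le> c \<bullet> F z" by (simp add: iff)
  moreover have "\<mu> * \<delta> * breg z y \<le> q * breg z y"
    unfolding q_def using e_bounds(1)[OF c] \<mu>_pos breg_nonneg[OF y z]
    by (intro mult_right_mono mult_left_mono) auto
  ultimately show ?thesis by linarith
qed

text \<open>For the multiplier \<open>c\<close> of this step the Jacobian term is known in every
  direction. Splitting \<open>z - x k\<close> at the new iterate allows smoothness on one piece and
  the three point identity on the other.\<close>

lemma step_inequality:
  assumes z: "z \<in> \<Omega>"
  obtains c where "c \<in> dual_gen C"
    "l * breg z (x (Suc k)) \<le> (l - \<mu> * \<delta>) * breg z (x k) + (L - l) * breg (x (Suc k)) (x k)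
      + c \<bullet> (F z - F (x (Suc k)))"
proof -
  let ?x = "x k" and ?y = "x (Suc k)"
  note int = iterates_interior[of k] iterates_interior[of "Suc k"]
  obtain c where c: "c \<in> dual_gen C" "\<And>w. c \<bullet> (J ?x *v w) = l * ((g ?x - g ?y) \<bullet> w)"
    using multiplier by metis
  have "c \<bullet> F ?y \<le> c \<bullet> F ?x + c \<bullet> (J ?x *v (?y - ?x)) + (L * breg ?y ?x) * (c \<bullet> e)"
    using smooth[OF int] c(1) by (simp add: cone_le_iff inner_add_right)
  also have "\<dots> \<le> c \<bullet> F ?x + c \<bullet> (J ?x *v (?y - ?x)) + (L * breg ?y ?x) * 1"
    using breg_nonneg[OF int(1) iterates_mem[of "Suc k"]] L_pos
    by (intro add_mono mult_left_mono e_bounds c) auto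
  finally have "c \<bullet> F ?y \<le> c \<bullet> F ?x + c \<bullet> (J ?x *v (?y - ?x)) + L * breg ?y ?x" by simp
  moreover have "c \<bullet> F ?x + c \<bullet> (J ?x *v (z - ?x)) + \<mu> * \<delta> * breg z ?x \<le> c \<bullet> F z"
    by (rule strong_closed[OF c(1) int(1) z])
  moreover have "c \<bullet> (J ?x *v (z - ?x)) = c \<bullet> (J ?x *v (z - ?y)) + c \<bullet> (J ?x *v (?y - ?x))"
    by (simp add: c(2) inner_diff_right algebra_simps)
  moreover have "c \<bullet> (J ?x *v (z - ?y)) = l * (breg z ?y + breg ?y ?x - breg z ?x)"
    by (simp add: c(2) breg_three_point)
  ultimately show thesis
    using that[OF c(1)] by (simp add: inner_diff_right algebra_simps)
qed

section \<open>Quasi-Fejer monotonicity and limit points\<close>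

lemma fejer_step:
  assumes z: "z \<in> \<Omega>" "\<And>k. cone_le C (F z) (F (x k))"
  shows "l * breg z (x (Suc k))
    \<le> (l - \<mu> * \<delta>) * breg z (x k) + (L - l) * breg (x (Suc k)) (x k)"
proof -
  obtain c where c: "c \<in> dual_gen C"
    "l * breg z (x (Suc k)) \<le> (l - \<mu> * \<delta>) * breg z (x k) + (L - l) * breg (x (Suc k)) (x k)
      + c \<bullet> (F z - F (x (Suc k)))"
    by (rule step_inequality[OF z(1)])
  moreover have "c \<bullet> (F z - F (x (Suc k))) \<le> 0"
    using z(2)[of "Suc k"] c(1) by (simp add: cone_le_iff inner_diff_right)
  ultimately show ?thesis by linarith
qed

text \<open>Gives up the contraction factor to reach the form of
  \<open>quasi_fejer_convergent\<close>. The absolute value covers \<open>l < L\<close>, which the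
  step size condition allows when \<open>\<alpha> > 0\<close>.\<close>

lemma weaken_step:
  assumes z: "z \<in> \<Omega>"
    and step: "l * breg z (x (Suc k))
      \<le> (l - \<mu> * \<delta>) * breg z (x k) + (L - l) * breg (x (Suc k)) (x k) - \<eta>"
  shows "breg z (x (Suc k)) \<le> breg z (x k) + \<bar>L - l\<bar> / l * breg (x (Suc k)) (x k) - \<eta> / l"
proof -
  have "(l - \<mu> * \<delta>) * breg z (x k) \<le> l * breg z (x k)"
    using \<mu>_pos \<delta>_pos breg_nonneg[OF iterates_interior z, of k] by (intro mult_right_mono) auto
  moreover have "(L - l) * breg (x (Suc k)) (x k) \<le> \<bar>L - l\<bar> * breg (x (Suc k)) (x k)"
    using breg_steps_nonneg[of k] by (intro mult_right_mono) auto
  ultimately have "l * breg z (x (Suc k))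
      \<le> l * breg z (x k) + \<bar>L - l\<bar> * breg (x (Suc k)) (x k) - \<eta>"
    using step by linarith
  also have "\<dots> = l * (breg z (x k) + \<bar>L - l\<bar> / l * breg (x (Suc k)) (x k) - \<eta> / l)"
    using l_pos by (simp add: field_simps)
  finally show ?thesis using l_pos by simp
qed

lemma summable_errors: "summable (\<lambda>k. \<bar>L - l\<bar> / l * breg (x (Suc k)) (x k))"
  by (intro summable_mult summable_breg_steps)

lemma errors_nonneg: "0 \<le> \<bar>L - l\<bar> / l * breg (x (Suc k)) (x k)"
  using l_pos breg_steps_nonneg[of k] by simp

text \<open>A point whose value is strictly below the limit would let the distance to the iterates
  decrease by a fixed amount in each step, up to a summable error.\<close>
lemma limit_not_dominated:
  assumes u: "\<And>k. cone_le C u (F (x k))" and z: "z \<in> \<Omega>"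
  shows "\<not> cone_less C (F z) u"
proof
  assume less: "cone_less C (F z) u"
  define \<eta> where "\<eta> = min_gen C (u - F z)"
  have \<eta>: "\<eta> > 0"
    unfolding \<eta>_def using less by (intro min_gen_pos_interior) (simp add: cone_less_def)
  define a where "a k = breg z (x k)" for k
  define b where "b k = \<bar>L - l\<bar> / l * breg (x (Suc k)) (x k)" for k
  have step: "a (Suc k) \<le> a k + b k - \<eta> / l" for k
    unfolding a_def b_def
  proof (rule weaken_step[OF z])
    obtain c where c: "c \<in> dual_gen C"
      "l * breg z (x (Suc k)) \<le> (l - \<mu> * \<delta>) * breg z (x k) + (L - l) * breg (x (Suc k)) (x k)
        + c \<bullet> (F z - F (x (Suc k)))"
      by (rule step_inequality[OF z])
    moreover have "c \<bullet> u \<le> c \<bullet> F (x (Suc k))"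
      using u[of "Suc k"] c(1) by (simp add: cone_le_iff)
    moreover have "\<eta> \<le> c \<bullet> (u - F z)"
      unfolding \<eta>_def by (rule min_gen_le[OF c(1)])
    ultimately show "l * breg z (x (Suc k))
        \<le> (l - \<mu> * \<delta>) * breg z (x k) + (L - l) * breg (x (Suc k)) (x k) - \<eta>"
      by (simp add: inner_diff_right)
  qed
  have b: "summable b" "\<And>k. 0 \<le> b k"
    unfolding b_def using summable_errors errors_nonneg by auto
  have "0 \<le> \<eta> / l" using \<eta> l_pos by simp
  have "convergent a"
  proof (rule quasi_fejer_convergent[OF _ _ b])
    show "a (Suc n) \<le> a n + b n" for n using step[of n] \<open>0 \<le> \<eta> / l\<close> by linarith
    show "0 \<le> a n" for n unfolding a_def by (rule breg_nonneg[OF iterates_interior z])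
  qed
  then obtain v where v: "a \<longlonglongrightarrow> v" by (auto simp: convergent_def)
  \<comment> \<open>The errors vanish in the limit, so the step inequality becomes
    \<open>v \<le> v - \<eta> / l\<close>.\<close>
  have "(\<lambda>k. a k + b k - \<eta> / l) \<longlonglongrightarrow> v + 0 - \<eta> / l"
    by (intro tendsto_intros v summable_LIMSEQ_zero b)
  with LIMSEQ_Suc[OF v] have "v \<le> v + 0 - \<eta> / l"
    by (rule LIMSEQ_le) (use step in auto)
  then show False using \<eta> l_pos by (simp add: field_simps)
qed

text \<open>The full sequence of distances converges by quasi-Fejer monotonicity, and the
  subsequence identifies its limit.\<close>

lemma breg_to_accumulation_point:
  assumes z: "z \<in> \<Omega>" "\<And>k. cone_le C (F z) (F (x k))"
    and r: "strict_mono r" "(\<lambda>n. breg z (x (r n))) \<longlonglongrightarrow> 0"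
  shows "(\<lambda>k. breg z (x k)) \<longlonglongrightarrow> 0"
proof -
  have "convergent (\<lambda>k. breg z (x k))"
  proof (rule quasi_fejer_convergent[OF _ _ summable_errors errors_nonneg])
    show "breg z (x (Suc k)) \<le> breg z (x k) + \<bar>L - l\<bar> / l * breg (x (Suc k)) (x k)" for k
      using weaken_step[OF z(1), of k 0] fejer_step[OF z, of k] by simp
    show "0 \<le> breg z (x k)" for k by (rule breg_nonneg[OF iterates_interior z(1)])
  qed
  then obtain v where v: "(\<lambda>k. breg z (x k)) \<longlonglongrightarrow> v" by (auto simp: convergent_def)
  with LIMSEQ_subseq_LIMSEQ[OF v r(1)] r(2) have "v = 0"
    by (auto simp: comp_def intro: LIMSEQ_unique)
  with v show ?thesis by simp
qed

end

section \<open>Legendre functions with extended real values\<close>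

lemma GDERIV_unique:
  assumes "GDERIV f x :> a" "GDERIV f x :> b" shows "a = b"
proof -
  have "(\<lambda>h. h \<bullet> a) = (\<lambda>h. h \<bullet> b)"
    using has_derivative_unique assms unfolding gderiv_def by blast
  then have "(a - b) \<bullet> a = (a - b) \<bullet> b" by metis
  then have "(a - b) \<bullet> (a - b) = 0" by (simp add: inner_diff_right)
  then show ?thesis by simp
qed

lemma differentiable_imp_GDERIV:
  fixes f :: "'a::euclidean_space \<Rightarrow> real"
  assumes "f differentiable (at x)" shows "\<exists>a. GDERIV f x :> a"
proof -
  obtain f' where f': "(f has_derivative f') (at x)"
    using assms by (auto simp: differentiable_def)
  then have "linear f'" by (rule has_derivative_linear)
  from adjoint_works[OF this, of _ 1] have "f' = (\<lambda>h. h \<bullet> adjoint f' 1)" by auto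
  from has_derivative_subst[OF f' this] show ?thesis unfolding gderiv_def by blast
qed

text \<open>Existence and uniqueness of the gradient justify the definite description in
  \<open>grad\<close>.\<close>

lemma GDERIV_grad:
  assumes "essentially_smooth \<omega>" "y \<in> interior (eff_dom \<omega>)"
  shows "GDERIV (\<lambda>z. real_of_ereal (\<omega> z)) y :> grad \<omega> y"
proof -
  obtain a where a: "GDERIV (\<lambda>z. real_of_ereal (\<omega> z)) y :> a"
    using assms differentiable_imp_GDERIV by (force simp: essentially_smooth_def)
  show ?thesis unfolding grad_def
    by (rule theI[of _ a]) (use a GDERIV_unique in auto)
qed

lemma proper_fun_real:
  assumes "proper_fun \<omega>" "z \<in> eff_dom \<omega>"
  shows "\<omega> z = ereal (real_of_ereal (\<omega> z))"
  using assms by (cases "\<omega> z") (auto simp: proper_fun_def eff_dom_def)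

lemma epi_eq:
  assumes "proper_fun \<omega>"
  shows "epi \<omega> = {(z, t). z \<in> eff_dom \<omega> \<and> real_of_ereal (\<omega> z) \<le> t}"
proof (intro set_eqI, clarify)
  fix z t
  show "(z, t) \<in> epi \<omega> \<longleftrightarrow> (z, t) \<in> {(z, t). z \<in> eff_dom \<omega> \<and> real_of_ereal (\<omega> z) \<le> t}"
    using assms by (cases "\<omega> z") (auto simp: epi_def eff_dom_def proper_fun_def)
qed

lemma legendre_fun_Legendre:
  fixes \<omega> :: "real^'n \<Rightarrow> ereal"
  assumes \<omega>: "Legendre \<omega>" "supercoercive \<omega>" and dom: "eff_dom \<omega> = \<Omega>"
    and \<Omega>: "closed \<Omega>" "convex \<Omega>"
  shows "legendre_fun \<Omega> (\<lambda>z. real_of_ereal (\<omega> z)) (grad \<omega>)"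
proof
  have proper: "proper_fun \<omega>" and smooth: "essentially_smooth \<omega>"
    using \<omega>(1) by (auto simp: Legendre_def)
  show "closed \<Omega>" "convex \<Omega>" by fact+
  have epi: "epi \<omega> = {(z, t). z \<in> \<Omega> \<and> real_of_ereal (\<omega> z) \<le> t}"
    using epi_eq[OF proper] dom by simp
  show "closed {(z, t). z \<in> \<Omega> \<and> real_of_ereal (\<omega> z) \<le> t}"
    using \<omega>(1) epi by (simp add: Legendre_def)
  have cvx: "convex {(z, t). z \<in> \<Omega> \<and> real_of_ereal (\<omega> z) \<le> t}"
    using \<omega>(1) epi by (simp add: Legendre_def)
  show "convex_on \<Omega> (\<lambda>z. real_of_ereal (\<omega> z))"
  proof (rule convex_onI)
    fix t :: real and u v assume t: "0 < t" "t < 1" and uv: "u \<in> \<Omega>" "v \<in> \<Omega>"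
    have "(1 - t) *\<^sub>R (u, real_of_ereal (\<omega> u)) + t *\<^sub>R (v, real_of_ereal (\<omega> v))
        \<in> {(z, t). z \<in> \<Omega> \<and> real_of_ereal (\<omega> z) \<le> t}"
      by (rule convexD[OF cvx]) (use t uv in auto)
    then show "real_of_ereal (\<omega> ((1 - t) *\<^sub>R u + t *\<^sub>R v))
        \<le> (1 - t) * real_of_ereal (\<omega> u) + t * real_of_ereal (\<omega> v)"
      by simp
  qed (fact \<Omega>(2))
  show "GDERIV (\<lambda>z. real_of_ereal (\<omega> z)) y :> grad \<omega> y" if "y \<in> interior \<Omega>" for y
    using GDERIV_grad[OF smooth] that dom by simp
  show "filterlim (\<lambda>k. norm (grad \<omega> (xs k))) at_top sequentially"
    if "\<And>k. xs k \<in> interior \<Omega>" "b \<in> frontier \<Omega>" "xs \<longlonglongrightarrow> b" for xs b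
    using smooth that dom unfolding essentially_smooth_def by blast
  show "\<exists>R. \<forall>z\<in>\<Omega>. R \<le> norm z \<longrightarrow> M * norm z \<le> real_of_ereal (\<omega> z)" for M
  proof -
    have "\<forall>\<^sub>F z in at_infinity. ereal M < \<omega> z / ereal (norm z)"
      using \<omega>(2) unfolding supercoercive_def by (rule order_tendstoD(1)) simp
    then obtain R where R: "\<And>z. R \<le> norm z \<Longrightarrow> ereal M < \<omega> z / ereal (norm z)"
      by (auto simp: eventually_at_infinity)
    \<comment> \<open>The bound \<open>max R 1\<close> keeps \<open>norm z\<close> positive, so the
      quotient can be cleared.\<close>
    have "M * norm z \<le> real_of_ereal (\<omega> z)" if z: "z \<in> \<Omega>" "max R 1 \<le> norm z" for z
    proof -
      have "norm z > 0" using z(2) by linarith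
      have "ereal M < ereal (real_of_ereal (\<omega> z)) / ereal (norm z)"
        using R[of z] z proper_fun_real[OF proper, of z] dom by simp
      then have "M < real_of_ereal (\<omega> z) / norm z" using \<open>norm z > 0\<close> by simp
      then show ?thesis using \<open>norm z > 0\<close> by (simp add: pos_less_divide_eq)
    qed
    then show ?thesis by blast
  qed
qed

lemma real_bregman:
  assumes "proper_fun \<omega>" "legendre_fun (eff_dom \<omega>) (\<lambda>z. real_of_ereal (\<omega> z)) (grad \<omega>)"
    "z \<in> eff_dom \<omega>" "y \<in> eff_dom \<omega>"
  shows "bregman \<omega> z y = ereal (legendre_fun.breg (\<lambda>z. real_of_ereal (\<omega> z)) (grad \<omega>) z y)"
proof -
  have "\<omega> z = ereal (real_of_ereal (\<omega> z))" "\<omega> y = ereal (real_of_ereal (\<omega> y))"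
    using assms proper_fun_real by blast+
  then show ?thesis
    unfolding bregman_def legendre_fun.breg_def[OF assms(2)]
    by (metis ereal_minus(1))
qed

text \<open>For an empty index set \<open>symmetry_coeff\<close> would be an unspecified infimum; a nonempty open
  set has two distinct points, so this does not occur.\<close>
lemma symmetry_coeff_bounds:
  fixes \<omega> :: "real^'n \<Rightarrow> ereal"
  assumes ne: "interior (eff_dom \<omega>) \<noteq> {}"
    and nonneg: "\<And>y z. y \<in> interior (eff_dom \<omega>) \<Longrightarrow> z \<in> interior (eff_dom \<omega>) \<Longrightarrow>
      0 \<le> real_of_ereal (bregman \<omega> y z)"
  shows "0 \<le> symmetry_coeff \<omega>"
    and "y \<in> interior (eff_dom \<omega>) \<Longrightarrow> z \<in> interior (eff_dom \<omega>) \<Longrightarrow>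
      symmetry_coeff \<omega> * real_of_ereal (bregman \<omega> y z) \<le> real_of_ereal (bregman \<omega> z y)"
proof -
  define A where "A = {real_of_ereal (bregman \<omega> x y) / real_of_ereal (bregman \<omega> y x) | x y.
            x \<in> interior (eff_dom \<omega>) \<and> y \<in> interior (eff_dom \<omega>) \<and> x \<noteq> y}"
  have \<alpha>: "symmetry_coeff \<omega> = Inf A" by (simp add: symmetry_coeff_def A_def)
  obtain p where p: "p \<in> interior (eff_dom \<omega>)" using ne by blast
  then obtain q where q: "q \<in> interior (eff_dom \<omega>)" "q \<noteq> p"
    using not_open_singleton[of p] open_interior[of "eff_dom \<omega>"]
    by (metis empty_iff insertI1 subset_singletonD subsetI)
  have "A \<noteq> {}" using p q unfolding A_def by blast
  have pos: "0 \<le> a" if "a \<in> A" for a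
    using that nonneg unfolding A_def by (auto intro!: divide_nonneg_nonneg)
  show "0 \<le> symmetry_coeff \<omega>"
    unfolding \<alpha> by (rule cInf_greatest[OF \<open>A \<noteq> {}\<close> pos])
  assume yz: "y \<in> interior (eff_dom \<omega>)" "z \<in> interior (eff_dom \<omega>)"
  show "symmetry_coeff \<omega> * real_of_ereal (bregman \<omega> y z) \<le> real_of_ereal (bregman \<omega> z y)"
  \<comment> \<open>A vanishing denominator is treated apart, because the ratio then has the default
    value 0 and carries no information.\<close>
  proof (cases "y = z \<or> real_of_ereal (bregman \<omega> y z) = 0")
    case True
    then show ?thesis
    proof
      assume "y = z"
      then have "real_of_ereal (bregman \<omega> y z) = 0"
        by (cases "\<omega> z") (simp_all add: bregman_def)
      with \<open>y = z\<close> show ?thesis by simp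
    qed (use nonneg[OF yz(2,1)] in simp)
  next
    case False
    then have "real_of_ereal (bregman \<omega> z y) / real_of_ereal (bregman \<omega> y z) \<in> A"
      using yz unfolding A_def by blast
    then have "symmetry_coeff \<omega> \<le> real_of_ereal (bregman \<omega> z y) / real_of_ereal (bregman \<omega> y z)"
      unfolding \<alpha> by (rule cInf_lower) (use pos in \<open>auto simp: bdd_below_def\<close>)
    moreover have "0 < real_of_ereal (bregman \<omega> y z)"
      using False nonneg[OF yz] by linarith
    ultimately show ?thesis by (simp add: pos_le_divide_eq)
  qed
qed

context solid_pointed_cone
begin

text \<open>Turns the extended-real maximization of the step into the real minimization problem
  treated for \<open>legendre_fun\<close>.\<close>

lemma step_objective_real:
  assumes "bregman \<omega> y x = ereal d"
  shows "step_objective C \<omega> F l x y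
    = ereal (- (max_gen C (jacobian F (at x) *v (y - x)) + l * d))"
proof -
  define v where "v = jacobian F (at x) *v (x - y)"
  have "v = - (jacobian F (at x) *v (y - x))"
    by (simp add: v_def matrix_vector_mult_diff_distrib)
  then have v: "min_gen C v = - max_gen C (jacobian F (at x) *v (y - x))"
    by (simp only: min_gen_uminus)
  obtain c where c: "c \<in> dual_gen C" "min_gen C v = c \<bullet> v" by (rule min_gen_attained)
  have "step_objective C \<omega> F l x y = ereal (min_gen C v - l * d)"
    unfolding step_objective_def assms v_def[symmetric]
  proof (rule INF_eqI)
    fix b assume "\<And>i. i \<in> dual_gen C \<Longrightarrow> b \<le> ereal (i \<bullet> v) - ereal l * ereal d"
    from this[OF c(1)] show "b \<le> ereal (min_gen C v - l * d)" by (simp add: c(2))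
  qed (simp add: min_gen_le)
  then show ?thesis by (simp add: v)
qed

end

theorem theorem4:
  fixes C :: "(real^'m) set" and \<Omega> :: "(real^'n) set"
    and F :: "real^'n \<Rightarrow> real^'m" and \<omega> :: "real^'n \<Rightarrow> ereal"
    and e :: "real^'m" and x :: "nat \<Rightarrow> real^'n"
    and r L \<mu> l :: real
  assumes C: "closed C" "convex C" "cone C" "pointed C" "interior C \<noteq> {}"
    and \<Omega>: "closed \<Omega>" "convex \<Omega>" "interior \<Omega> \<noteq> {}"
    and F: "\<And>z. F differentiable (at z)"
    and \<omega>: "Legendre \<omega>" "closure (eff_dom \<omega>) = \<Omega>" "supercoercive \<omega>"
    and e: "normalized_direction C r e"
    and level_bounded: "bounded {z. cone_le C (F z) (F (x 0))}"
    and smooth: "L > 0" "rel_smooth L C e \<Omega> \<omega> F"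
    and l: "l > 0" "l > L / (1 + symmetry_coeff \<omega>)"
    and strong: "\<mu> > 0" "rel_strongly_convex \<mu> C e \<Omega> \<omega> F"
    and x0: "x 0 \<in> interior \<Omega>"
    and iter: "\<And>k. x (Suc k) = bregman_step C \<Omega> \<omega> F l (x k)"
    and nonstationary: "\<And>k. \<not> C_stationary C \<Omega> F (x k)"
  shows "(\<exists>Fstar. (\<forall>k. cone_le C Fstar (F (x k))) \<and> (\<lambda>k. F (x k)) \<longlonglongrightarrow> Fstar)
    \<and> (\<Sum>k. bregman \<omega> (x (Suc k)) (x k)) < \<infinity>
    \<and> (\<forall>xbar. accumulation_point x xbar \<longrightarrow> weakly_efficient C \<Omega> F xbar)
    \<and> (bregman_convergence \<Omega> \<omega> \<longrightarrow>
         (\<exists>xstar. weakly_efficient C \<Omega> F xstar \<and> x \<longlonglongrightarrow> xstar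
            \<and> (l \<ge> L \<longrightarrow>
                (\<forall>k. bregman \<omega> xstar (x (Suc k))
                       \<le> ereal ((l - min_gen C e * \<mu>) / l) * bregman \<omega> xstar (x k)))))"
proof -
  interpret cone: solid_pointed_cone C by unfold_locales (fact C)+
  have proper: "proper_fun \<omega>" using \<omega>(1) by (simp add: Legendre_def)
  \<comment> \<open>Relative smoothness includes
    \<open>\<Omega> \<subseteq> eff_dom \<omega>\<close>, and the closure condition gives the
    reverse inclusion.\<close>
  have dom: "eff_dom \<omega> = \<Omega>"
    using smooth(2) \<omega>(2) closure_subset by (auto simp: rel_smooth_def)
  have leg: "legendre_fun \<Omega> (\<lambda>z. real_of_ereal (\<omega> z)) (grad \<omega>)"
    by (rule legendre_fun_Legendre[OF \<omega>(1,3) dom \<Omega>(1,2)])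
  interpret leg: legendre_fun \<Omega> "\<lambda>z. real_of_ereal (\<omega> z)" "grad \<omega>" by (fact leg)
  define J where "J y = jacobian F (at y)" for y
  have int: "y \<in> \<Omega>" if "y \<in> interior \<Omega>" for y using that interior_subset by blast
  have breg: "bregman \<omega> z y = ereal (leg.breg z y)" if "z \<in> \<Omega>" "y \<in> \<Omega>" for z y
    using real_bregman[OF proper, of z y] leg that by (simp add: dom)
  have \<alpha>: "0 \<le> symmetry_coeff \<omega>"
    by (rule symmetry_coeff_bounds(1)) (use \<Omega>(3) leg.breg_nonneg int breg dom in auto)
  have sym: "symmetry_coeff \<omega> * leg.breg y z \<le> leg.breg z y"
    if "y \<in> interior \<Omega>" "z \<in> interior \<Omega>" for y z
    using symmetry_coeff_bounds(2)[of \<omega> y z] \<Omega>(3) leg.breg_nonneg int breg dom that by simp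
  have step: "x (Suc k) \<in> \<Omega> \<and> (\<forall>z\<in>\<Omega>.
      max_gen C (J (x k) *v (x (Suc k) - x k)) + l * leg.breg (x (Suc k)) (x k)
        \<le> max_gen C (J (x k) *v (z - x k)) + l * leg.breg z (x k))"
    if xk: "x k \<in> interior \<Omega>" for k
  proof -
    define h where "h z = max_gen C (J (x k) *v (z - x k)) + l * leg.breg z (x k)" for z
    have obj: "step_objective C \<omega> F l (x k) z = ereal (- h z)" if "z \<in> \<Omega>" for z
      unfolding h_def J_def
      by (rule cone.step_objective_real) (rule breg[OF that int[OF xk]])
    have max_iff: "is_arg_max (step_objective C \<omega> F l (x k)) (\<lambda>z. z \<in> \<Omega>) y
        \<longleftrightarrow> y \<in> \<Omega> \<and> (\<forall>z\<in>\<Omega>. h y \<le> h z)" for y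
      by (auto simp: is_arg_max_linorder obj)
    have "\<exists>y. y \<in> \<Omega> \<and> (\<forall>z\<in>\<Omega>. h y \<le> h z)"
      using leg.prox_exists[OF xk l(1) cone.lipschitz_max_gen] unfolding h_def by blast
    \<comment> \<open>\<open>bregman_step\<close> selects by choice, so existence of a maximizer is
      enough to make the iterate one.\<close>
    then have "is_arg_max (step_objective C \<omega> F l (x k)) (\<lambda>z. z \<in> \<Omega>) (x (Suc k))"
      unfolding iter bregman_step_def arg_max_on_def arg_max_def max_iff by (rule someI_ex)
    then show ?thesis by (simp add: max_iff h_def)
  qed
  interpret bregman_gradient C \<Omega> "\<lambda>z. real_of_ereal (\<omega> z)" "grad \<omega>" F J e L \<mu> l
    "symmetry_coeff \<omega>" "min_gen C e" x
  proof
    show "continuous_on UNIV F"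
      using F by (simp add: continuous_on_eq_continuous_at differentiable_imp_continuous_within)
    show "min_gen C e \<le> c \<bullet> e" if "c \<in> dual_gen C" for c by (rule min_gen_le[OF that])
    show "c \<bullet> e \<le> 1" if "c \<in> dual_gen C" for c
      using max_gen_ge[OF that, of e] e by (simp add: normalized_direction_def)
    show "0 < min_gen C e" by (rule cone.min_gen_normalized_direction_pos[OF e])
    show "0 < L" "0 < \<mu>" "0 < l" by fact+
    show "cone_le C (F z) (F y + J y *v (z - y) + (L * leg.breg z y) *\<^sub>R e)"
      if "y \<in> interior \<Omega>" "z \<in> interior \<Omega>" for y z
      using smooth(2) that breg[OF int int] unfolding rel_smooth_def J_def by fastforce
    show "cone_le C (F y + J y *v (z - y) + (\<mu> * leg.breg z y) *\<^sub>R e) (F z)"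
      if "y \<in> interior \<Omega>" "z \<in> interior \<Omega>" for y z
      using strong(2) that breg[OF int int] unfolding rel_strongly_convex_def J_def by fastforce
    show "symmetry_coeff \<omega> * leg.breg y z \<le> leg.breg z y"
      if "y \<in> interior \<Omega>" "z \<in> interior \<Omega>" for y z by (rule sym[OF that])
    show "L < l * (1 + symmetry_coeff \<omega>)"
      using l(2) \<alpha> by (simp add: pos_divide_less_eq)
    show "x 0 \<in> interior \<Omega>" "bounded {z. cone_le C (F z) (F (x 0))}" by fact+
  qed (use step in blast)+
  obtain u where u: "\<And>k. cone_le C u (F (x k))" "(\<lambda>k. F (x k)) \<longlonglongrightarrow> u"
    using values_converge by metis
  have acc: "xbar \<in> \<Omega> \<and> F xbar = u \<and> weakly_efficient C \<Omega> F xbar"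
    if xbar: "accumulation_point x xbar" for xbar
  proof -
    obtain s :: "nat \<Rightarrow> nat" where s: "strict_mono s" "(x \<circ> s) \<longlonglongrightarrow> xbar"
      using xbar by (auto simp: accumulation_point_def)
    have "xbar \<in> \<Omega>"
      by (rule closed_sequentially[OF \<Omega>(1) _ s(2)]) (simp add: iterates_mem)
    moreover have "isCont F xbar"
      using F by (simp add: differentiable_imp_continuous_within)
    then have "(\<lambda>n. F (x (s n))) \<longlonglongrightarrow> F xbar"
      using isCont_tendsto_compose[OF _ s(2)] by (simp add: comp_def)
    then have "F xbar = u"
      using LIMSEQ_subseq_LIMSEQ[OF u(2) s(1)] by (auto simp: comp_def intro: LIMSEQ_unique)
    ultimately show ?thesis
      using limit_not_dominated[OF u(1)] by (auto simp: weakly_efficient_def)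
  qed
  have "(\<Sum>k. bregman \<omega> (x (Suc k)) (x k)) < \<infinity>"
    using suminf_ereal_finite[OF summable_breg_steps]
    by (simp add: breg iterates_mem less_top[symmetric])
  moreover have "\<exists>xstar. weakly_efficient C \<Omega> F xstar \<and> x \<longlonglongrightarrow> xstar
      \<and> (l \<ge> L \<longrightarrow> (\<forall>k. bregman \<omega> xstar (x (Suc k))
            \<le> ereal ((l - min_gen C e * \<mu>) / l) * bregman \<omega> xstar (x k)))"
    if conv: "bregman_convergence \<Omega> \<omega>"
  proof -
    \<comment> \<open>Boundedness supplies a candidate. The first half of
      \<open>bregman_convergence\<close> sends its distances to zero along \<open>s\<close>,
      quasi-Fejer monotonicity along all iterates, and the second half returns convergence of
      \<open>x\<close>.\<close>
    obtain xstar s where s: "strict_mono s" "(x \<circ> s) \<longlonglongrightarrow> xstar"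
      using bounded_imp_convergent_subsequence[OF bounded_iterates] by blast
    then have star: "xstar \<in> \<Omega>" "F xstar = u" "weakly_efficient C \<Omega> F xstar"
      using acc by (auto simp: accumulation_point_def)
    have below: "cone_le C (F xstar) (F (x k))" for k using u(1) star(2) by simp
    have "\<forall>n. (x \<circ> s) n \<in> interior \<Omega>" using iterates_interior by simp
    then have "(\<lambda>n. bregman \<omega> xstar ((x \<circ> s) n)) \<longlonglongrightarrow> 0"
      using conv s(2) star(1) unfolding bregman_convergence_def by blast
    then have "(\<lambda>n. leg.breg xstar (x (s n))) \<longlonglongrightarrow> 0"
      by (simp add: breg star(1) iterates_mem zero_ereal_def)
    then have "(\<lambda>k. leg.breg xstar (x k)) \<longlonglongrightarrow> 0"
      by (rule breg_to_accumulation_point[OF star(1) below s(1)])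
    then have "(\<lambda>k. bregman \<omega> xstar (x k)) \<longlonglongrightarrow> 0"
      by (simp add: breg star(1) iterates_mem zero_ereal_def)
    then have "x \<longlonglongrightarrow> xstar"
      using conv star(1) iterates_interior unfolding bregman_convergence_def by blast
    moreover have "bregman \<omega> xstar (x (Suc k))
        \<le> ereal ((l - min_gen C e * \<mu>) / l) * bregman \<omega> xstar (x k)" if "L \<le> l" for k
    proof -
      have "(L - l) * leg.breg (x (Suc k)) (x k) \<le> 0"
        using that breg_steps_nonneg[of k] by (simp add: mult_nonpos_nonneg)
      then have "l * leg.breg xstar (x (Suc k)) \<le> (l - min_gen C e * \<mu>) * leg.breg xstar (x k)"
        using fejer_step[OF star(1) below, of k] by (simp add: mult.commute)
      then have "leg.breg xstar (x (Suc k)) \<le> (l - min_gen C e * \<mu>) / l * leg.breg xstar (x k)"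
        using l(1) by (simp add: pos_le_divide_eq mult.commute)
      then show ?thesis by (simp add: breg star(1) iterates_mem)
    qed
    ultimately show ?thesis using star(3) by blast
  qed
  ultimately show ?thesis using u acc by blast
qed

end
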